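(* Let $\mathbb X$ be a Cartesian tangent join restriction category, $(G,m,u,\iota)$ a group object in $\mathbb X$ (with $m,u,\iota$ total) and $q:P\to M$ a principal $G$-bundle in $\mathbb X$. If the restriction pullback $T(G)_u$ of $p_G:T(G)\to G$ along $u:1\to G$ exists, then the vertical bundle $T_0(P)$, i.e. the restriction pullback of $T(q):T(P)\to T(M)$ along $0_M:M\to T(M)$, exists and is isomorphic to $P\times T(G)_u$.
   Context: Composition is written in diagrammatic order: $fg$ means first $f$, then $g$. A restriction category assigns to each $f:A\to B$ a map $\bar f:A\to A$ with $\bar ff=f$, $\bar g\bar f=\bar f\bar g$, $\overline{\bar gf}=\bar g\bar f$, $f\bar h=\overline{fh}f$. Write $f\le g$ if $\bar fg=f$, and $f\smile g$ (compatible) if $\bar fg=\bar gf$. $f$ is total if $\bar f=1$; $e$ is a restriction idempotent if $e=\bar e$; $f$ is a partial isomorphism with partial inverse $f^*$ if $ff^*=\bar f$, $f^*f=\overline{f^*}$. A join restriction category is one in which every set $S$ of pairwise compatible parallel maps has a supremum $\bigvee S$ for $\le$, with $\overline{\bigvee s}=\bigvee\bar s$ and $g\bigvee s=\bigvee gs$. Restriction products: total projections and unique pairings with $\langle f,g\rangle\pi_0=\bar gf$, $\langle f,g\rangle\pi_1=\bar fg$. The restriction pullback of total maps $f:A\to B\leftarrow C:g$ is an object $X$ with total $p_A,p_C$, $p_Af=p_Cg$, such that for all (possibly partial) $r_A,r_C$ with $r_Af=r_Cg$ there is a unique $h$ with $hp_A=r_A$, $hp_C=r_C$. A Cartesian tangent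 join restriction category is a join restriction category $\mathbb X$ with finite restriction products (restriction terminal object $1$) and a functor $T:\mathbb X\to\mathbb X$ with $T(\bar f)=\overline{T(f)}$ preserving restriction products (identifications suppressed), with: total natural transformations $p:T\to1$, $0:1\to T$, $+:T_2\to T$, where $T_n(M)$ is the restriction pullback of $n$ copies of $p_M$ (assumed to exist and to be preserved by all $T^k$), making each $p_M$ an additive bundle (commutative monoid over $M$); a total natural transformation $\ell:T\to T^2$ with $(\ell_M,0_M)$ an additive bundle morphism from $(p_M,+_M,0_M)$ to $(T(p_M),T(+_M),T(0_M))$; a total natural transformation $c:T^2\to T^2$ with $(c_M,1)$ an additive bundle morphism from $(T(p_M),T(+_M),T(0_M))$ to $(p_{TM},+_{TM},0_{TM})$; $c^2=1$, $\ell c=\ell$, $\ell T(\ell)=\ell\,\ell_T$, $T(c)c_TT(c)=c_TT(c)c_T$, $\ell_TT(c)c_T=cT(\ell)$; and the square with sides $\langle\pi_0\ell,\pi_10_T\rangle T(+):T_2M\to T^2M$, $T(p):T^2M\to TM$, $\pi_0p:T_2M\to M$, $0_M:M\to TM$ is a restriction pullback. A fibre bundle over $M$ with typical fibre $F$ is an object $E$ with a total map $q:E\to M$ and partial isomorphisms $\alpha_i:E\to M\times F$ ($i\in I$) with $\alpha_i\pi_0=\bar\alpha_iq$, $\bigvee_i\bar\alpha_i=1_E$, and for each $i$ a restriction idempotent $e_i:M\to M$ with $\overline{\alpha_i^*}=e_i\times1_F$. A $G$-atlas on $M$ is a family $\tau_{ij}:M\to G$ with $\langle\tau_{ij},\tau_{jk}\rangle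 m\le\tau_{ik}$, $\tau_{ii}\le\,!u$, $\tau_{ji}=\tau_{ij}\iota$. A principal $G$-bundle over $M$ is a fibre bundle $(P,M,q,(\alpha_i))$ with fibre $G$ and a $G$-atlas $(\tau_{ij})$ such that $\alpha_i^*\alpha_j=\langle\pi_0,\langle\pi_0\tau_{ji},\pi_1\rangle m\rangle:M\times G\to M\times G$. *)

theory Defs
  imports Main
begin

section \<open>Categories\<close>

text \<open>
  Composition is diagrammatic: \<open>f \<cdot> g\<close> is first \<open>f\<close>, then \<open>g\<close>. It is meaningful only
  if \<open>cod f = dom g\<close>; its values on other pairs are unspecified.
\<close>

record ('o, 'a) cat =
  Obj :: "'o set"
  Arr :: "'a set"
  Dom :: "'a \<Rightarrow> 'o"
  Cod :: "'a \<Rightarrow> 'o"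
  ident :: "'o \<Rightarrow> 'a"  ("\<one>\<index>")
  cmp :: "'a \<Rightarrow> 'a \<Rightarrow> 'a"  (infixl "\<cdot>\<index>" 70)

definition hom :: "('o, 'a, 'z) cat_scheme \<Rightarrow> 'o \<Rightarrow> 'o \<Rightarrow> 'a set" where
  "hom X A B = {f \<in> Arr X. Dom X f = A \<and> Cod X f = B}"

locale category =
  fixes X :: "('o, 'a, 'z) cat_scheme" (structure)
  assumes Dom_Obj: "f \<in> Arr X \<Longrightarrow> Dom X f \<in> Obj X"
    and Cod_Obj: "f \<in> Arr X \<Longrightarrow> Cod X f \<in> Obj X"
    and ident_hom: "A \<in> Obj X \<Longrightarrow> \<one> A \<in> hom X A A"
    and cmp_hom: "\<lbrakk>f \<in> hom X A B; g \<in> hom X B C\<rbrakk> \<Longrightarrow> f \<cdot> g \<in> hom X A C"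
    and ident_cmp: "f \<in> hom X A B \<Longrightarrow> \<one> A \<cdot> f = f"
    and cmp_ident: "f \<in> hom X A B \<Longrightarrow> f \<cdot> \<one> B = f"
    and cmp_assoc: "\<lbrakk>f \<in> hom X A B; g \<in> hom X B C; h \<in> hom X C D\<rbrakk>
          \<Longrightarrow> (f \<cdot> g) \<cdot> h = f \<cdot> (g \<cdot> h)"

definition isomorphic :: "('o, 'a, 'z) cat_scheme \<Rightarrow> 'o \<Rightarrow> 'o \<Rightarrow> bool" where
  "isomorphic X A B \<longleftrightarrow>
     (\<exists>f \<in> hom X A B. \<exists>g \<in> hom X B A. f \<cdot> g = \<one> A \<and> g \<cdot> f = \<one> B)" for X (structure)


section \<open>Restriction categories and joins\<close>

record ('o, 'a) rcat = "('o, 'a) cat" +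
  rst :: "'a \<Rightarrow> 'a"  ("\<rho>\<index> _" [81] 80)

locale restriction_category = category X
  for X :: "('o, 'a, 'z) rcat_scheme" (structure) +
  assumes rst_hom: "f \<in> hom X A B \<Longrightarrow> \<rho> f \<in> hom X A A"
    and rst_cmp_self: "f \<in> hom X A B \<Longrightarrow> \<rho> f \<cdot> f = f"
    and rst_commute: "\<lbrakk>f \<in> hom X A B; g \<in> hom X A C\<rbrakk> \<Longrightarrow> \<rho> g \<cdot> \<rho> f = \<rho> f \<cdot> \<rho> g"
    and rst_rst_cmp: "\<lbrakk>f \<in> hom X A B; g \<in> hom X A C\<rbrakk> \<Longrightarrow> \<rho> (\<rho> g \<cdot> f) = \<rho> g \<cdot> \<rho> f"
    and cmp_rst: "\<lbrakk>f \<in> hom X A B; h \<in> hom X B C\<rbrakk> \<Longrightarrow> f \<cdot> \<rho> h = \<rho> (f \<cdot> h) \<cdot> f"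

definition total :: "('o, 'a, 'z) rcat_scheme \<Rightarrow> 'a \<Rightarrow> bool" where
  "total X f \<longleftrightarrow> \<rho> f = \<one> (Dom X f)" for X (structure)

definition total_hom :: "('o, 'a, 'z) rcat_scheme \<Rightarrow> 'o \<Rightarrow> 'o \<Rightarrow> 'a set" where
  "total_hom X A B = {f \<in> hom X A B. total X f}"

definition restriction_idempotent :: "('o, 'a, 'z) rcat_scheme \<Rightarrow> 'a \<Rightarrow> bool" where
  "restriction_idempotent X e \<longleftrightarrow> e \<in> Arr X \<and> e = \<rho> e" for X (structure)

text \<open>The next two relations are meant for parallel maps.\<close>

definition rle :: "('o, 'a, 'z) rcat_scheme \<Rightarrow> 'a \<Rightarrow> 'a \<Rightarrow> bool"  (infix "\<preceq>\<index>" 50) where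
  "f \<preceq> g \<longleftrightarrow> \<rho> f \<cdot> g = f" for X (structure)

definition compatible :: "('o, 'a, 'z) rcat_scheme \<Rightarrow> 'a \<Rightarrow> 'a \<Rightarrow> bool"  (infix "\<smile>\<index>" 50) where
  "f \<smile> g \<longleftrightarrow> \<rho> f \<cdot> g = \<rho> g \<cdot> f" for X (structure)

definition is_partial_inverse :: "('o, 'a, 'z) rcat_scheme \<Rightarrow> 'a \<Rightarrow> 'a \<Rightarrow> bool" where
  "is_partial_inverse X f g \<longleftrightarrow>
     f \<in> Arr X \<and> g \<in> hom X (Cod X f) (Dom X f) \<and> f \<cdot> g = \<rho> f \<and> g \<cdot> f = \<rho> g" for X (structure)

definition partial_isomorphism :: "('o, 'a, 'z) rcat_scheme \<Rightarrow> 'a \<Rightarrow> bool" where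
  "partial_isomorphism X f \<longleftrightarrow> (\<exists>g. is_partial_inverse X f g)"

definition partial_inverse :: "('o, 'a, 'z) rcat_scheme \<Rightarrow> 'a \<Rightarrow> 'a" where
  "partial_inverse X f = (THE g. is_partial_inverse X f g)"

text \<open>\<open>is_join X A B S s\<close>: \<open>s\<close> is the supremum of \<open>S\<close> in the partial order \<open>hom X A B\<close>.\<close>

definition is_join :: "('o, 'a, 'z) rcat_scheme \<Rightarrow> 'o \<Rightarrow> 'o \<Rightarrow> 'a set \<Rightarrow> 'a \<Rightarrow> bool" where
  "is_join X A B S s \<longleftrightarrow>
     S \<subseteq> hom X A B \<and> s \<in> hom X A B \<and> (\<forall>f\<in>S. f \<preceq> s) \<and>
     (\<forall>t \<in> hom X A B. (\<forall>f\<in>S. f \<preceq> t) \<longrightarrow> s \<preceq> t)" for X (structure)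

locale join_restriction_category = restriction_category X
  for X :: "('o, 'a, 'z) rcat_scheme" (structure) +
  assumes join_exists: "\<lbrakk>A \<in> Obj X; B \<in> Obj X; S \<subseteq> hom X A B; \<forall>f\<in>S. \<forall>g\<in>S. f \<smile> g\<rbrakk>
          \<Longrightarrow> \<exists>s. is_join X A B S s"
    and rst_join: "is_join X A B S s \<Longrightarrow> is_join X A A ((\<lambda>f. \<rho> f) ` S) (\<rho> s)"
    and cmp_join: "\<lbrakk>is_join X A B S s; g \<in> hom X C A\<rbrakk>
          \<Longrightarrow> is_join X C B ((\<lambda>f. g \<cdot> f) ` S) (g \<cdot> s)"


section \<open>Restriction limits\<close>

definition restriction_terminal :: "('o, 'a, 'z) rcat_scheme \<Rightarrow> 'o \<Rightarrow> bool" where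
  "restriction_terminal X Y \<longleftrightarrow>
     Y \<in> Obj X \<and> (\<forall>A \<in> Obj X. \<exists>!t. t \<in> total_hom X A Y) \<and>
     (\<forall>A B. \<forall>f \<in> hom X A B. \<forall>s \<in> total_hom X A Y. \<forall>t \<in> total_hom X B Y. f \<cdot> t \<preceq> s)"
  for X (structure)

definition restriction_product ::
    "('o, 'a, 'z) rcat_scheme \<Rightarrow> 'o \<Rightarrow> 'o \<Rightarrow> 'o \<Rightarrow> 'a \<Rightarrow> 'a \<Rightarrow> bool" where
  "restriction_product X A B Y r s \<longleftrightarrow>
     r \<in> total_hom X Y A \<and> s \<in> total_hom X Y B \<and>
     (\<forall>Z. \<forall>f \<in> hom X Z A. \<forall>g \<in> hom X Z B.
        \<exists>!h. h \<in> hom X Z Y \<and> h \<cdot> r = \<rho> g \<cdot> f \<and> h \<cdot> s = \<rho> f \<cdot> g)" for X (structure)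

definition restriction_pullback ::
    "('o, 'a, 'z) rcat_scheme \<Rightarrow> 'a \<Rightarrow> 'a \<Rightarrow> 'o \<Rightarrow> 'a \<Rightarrow> 'a \<Rightarrow> bool" where
  "restriction_pullback X f g Y r s \<longleftrightarrow>
     f \<in> Arr X \<and> g \<in> Arr X \<and> Cod X f = Cod X g \<and> total X f \<and> total X g \<and>
     r \<in> total_hom X Y (Dom X f) \<and> s \<in> total_hom X Y (Dom X g) \<and> r \<cdot> f = s \<cdot> g \<and>
     (\<forall>Z. \<forall>a \<in> hom X Z (Dom X f). \<forall>b \<in> hom X Z (Dom X g). a \<cdot> f = b \<cdot> g \<longrightarrow>
        (\<exists>!h. h \<in> hom X Z Y \<and> h \<cdot> r = a \<and> h \<cdot> s = b))" for X (structure)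

text \<open>
  Restriction pullback of \<open>n\<close> copies of \<open>f\<close>, with projections \<open>r 0, \<dots>, r (n - 1)\<close>. This is
  the correct notion only for \<open>n \<ge> 1\<close>; the case \<open>n = 0\<close> is never used (the pullback of no
  copies of \<open>f\<close> over its codomain is the codomain itself).
\<close>

definition restriction_pullback_power ::
    "('o, 'a, 'z) rcat_scheme \<Rightarrow> nat \<Rightarrow> 'a \<Rightarrow> 'o \<Rightarrow> (nat \<Rightarrow> 'a) \<Rightarrow> bool" where
  "restriction_pullback_power X n f Y r \<longleftrightarrow>
     f \<in> Arr X \<and> total X f \<and> (\<forall>i<n. r i \<in> total_hom X Y (Dom X f)) \<and>
     (\<forall>i<n. \<forall>j<n. r i \<cdot> f = r j \<cdot> f) \<and>
     (\<forall>Z a. (\<forall>i<n. a i \<in> hom X Z (Dom X f)) \<and> (\<forall>i<n. \<forall>j<n. a i \<cdot> f = a j \<cdot> f) \<longrightarrow>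
        (\<exists>!h. h \<in> hom X Z Y \<and> (\<forall>i<n. h \<cdot> r i = a i)))" for X (structure)

text \<open>The map \<open>\<langle>a, b\<rangle>\<close> into a pullback with projections \<open>r\<close> and \<open>s\<close>.\<close>

definition pullback_pair :: "('o, 'a, 'z) rcat_scheme \<Rightarrow> 'a \<Rightarrow> 'a \<Rightarrow> 'a \<Rightarrow> 'a \<Rightarrow> 'a" where
  "pullback_pair X r s a b =
     (THE h. h \<in> hom X (Dom X a) (Dom X r) \<and> h \<cdot> r = a \<and> h \<cdot> s = b)" for X (structure)


section \<open>Cartesian restriction categories\<close>

record ('o, 'a) cart_rcat = "('o, 'a) rcat" +
  term_obj :: 'o
  prd :: "'o \<Rightarrow> 'o \<Rightarrow> 'o"  (infixr "\<otimes>\<index>" 80)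
  prj0 :: "'o \<Rightarrow> 'o \<Rightarrow> 'a"  ("\<pi>\<^sub>0\<index>")
  prj1 :: "'o \<Rightarrow> 'o \<Rightarrow> 'a"  ("\<pi>\<^sub>1\<index>")

locale cartesian_restriction_category = restriction_category X
  for X :: "('o, 'a, 'z) cart_rcat_scheme" (structure) +
  assumes term_obj_terminal: "restriction_terminal X (term_obj X)"
    and prd_product: "\<lbrakk>A \<in> Obj X; B \<in> Obj X\<rbrakk>
          \<Longrightarrow> restriction_product X A B (A \<otimes> B) (\<pi>\<^sub>0 A B) (\<pi>\<^sub>1 A B)"

definition bang :: "('o, 'a, 'z) cart_rcat_scheme \<Rightarrow> 'o \<Rightarrow> 'a" where
  "bang X A = (THE t. t \<in> total_hom X A (term_obj X))"

definition rpair :: "('o, 'a, 'z) cart_rcat_scheme \<Rightarrow> 'a \<Rightarrow> 'a \<Rightarrow> 'a"  ("\<langle>_,/ _\<rangle>\<index>") where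
  "\<langle>f, g\<rangle> = (THE h. h \<in> hom X (Dom X f) (Cod X f \<otimes> Cod X g) \<and>
     h \<cdot> \<pi>\<^sub>0 (Cod X f) (Cod X g) = \<rho> g \<cdot> f \<and> h \<cdot> \<pi>\<^sub>1 (Cod X f) (Cod X g) = \<rho> f \<cdot> g)"
  for X (structure)

definition prd_map :: "('o, 'a, 'z) cart_rcat_scheme \<Rightarrow> 'a \<Rightarrow> 'a \<Rightarrow> 'a" where
  "prd_map X f g = \<langle>\<pi>\<^sub>0 (Dom X f) (Dom X g) \<cdot> f, \<pi>\<^sub>1 (Dom X f) (Dom X g) \<cdot> g\<rangle>" for X (structure)


section \<open>Additive bundles\<close>

text \<open>
  An additive bundle is a commutative monoid over the base \<open>Cod (bproj b)\<close>, where \<open>bpow b n\<close> with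
  projections \<open>bprj b n i\<close> (\<open>i < n\<close>) is a restriction pullback of \<open>n\<close> copies of \<open>bproj b\<close>.
\<close>

record ('o, 'a) fibred_monoid =
  bproj :: 'a
  bpow :: "nat \<Rightarrow> 'o"
  bprj :: "nat \<Rightarrow> nat \<Rightarrow> 'a"
  bplus :: 'a
  bzero :: 'a

definition bundle_pair ::
    "('o, 'a, 'z) rcat_scheme \<Rightarrow> ('o, 'a) fibred_monoid \<Rightarrow> 'a \<Rightarrow> 'a \<Rightarrow> 'a" where
  "bundle_pair X b f g = pullback_pair X (bprj b 2 0) (bprj b 2 1) f g"

definition bundle_add ::
    "('o, 'a, 'z) rcat_scheme \<Rightarrow> ('o, 'a) fibred_monoid \<Rightarrow> 'a \<Rightarrow> 'a \<Rightarrow> 'a" where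
  "bundle_add X b f g = bundle_pair X b f g \<cdot> bplus b" for X (structure)

definition additive_bundle :: "('o, 'a, 'z) rcat_scheme \<Rightarrow> ('o, 'a) fibred_monoid \<Rightarrow> bool" where
  "additive_bundle X b \<longleftrightarrow>
     (let E = Dom X (bproj b); B = Cod X (bproj b) in
      bproj b \<in> total_hom X E B \<and>
      (\<forall>n\<ge>1. restriction_pullback_power X n (bproj b) (bpow b n) (bprj b n)) \<and>
      bplus b \<in> total_hom X (bpow b 2) E \<and>
      bzero b \<in> total_hom X B E \<and>
      bplus b \<cdot> bproj b = bprj b 2 0 \<cdot> bproj b \<and>
      bzero b \<cdot> bproj b = \<one> B \<and>
      bundle_add X b (bundle_add X b (bprj b 3 0) (bprj b 3 1)) (bprj b 3 2) =
        bundle_add X b (bprj b 3 0) (bundle_add X b (bprj b 3 1) (bprj b 3 2)) \<and>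
      bundle_add X b (bprj b 2 1) (bprj b 2 0) = bplus b \<and>
      bundle_add X b (\<one> E) (bproj b \<cdot> bzero b) = \<one> E)" for X (structure)

definition additive_bundle_morphism ::
    "('o, 'a, 'z) rcat_scheme \<Rightarrow> ('o, 'a) fibred_monoid \<Rightarrow> ('o, 'a) fibred_monoid \<Rightarrow> 'a \<Rightarrow> 'a \<Rightarrow> bool" where
  "additive_bundle_morphism X b b' f g \<longleftrightarrow>
     additive_bundle X b \<and> additive_bundle X b' \<and>
     f \<in> hom X (Dom X (bproj b)) (Dom X (bproj b')) \<and>
     g \<in> hom X (Cod X (bproj b)) (Cod X (bproj b')) \<and>
     f \<cdot> bproj b' = bproj b \<cdot> g \<and>
     bplus b \<cdot> f = bundle_add X b' (bprj b 2 0 \<cdot> f) (bprj b 2 1 \<cdot> f) \<and>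
     bzero b \<cdot> f = g \<cdot> bzero b'" for X (structure)


section \<open>Cartesian tangent join restriction categories\<close>

text \<open>
  \<open>\<T>\<close> and \<open>\<T>\<^sub>m\<close> are the object and arrow parts of the tangent functor; \<open>tpow n M\<close> is the
  chosen restriction pullback of \<open>n \<ge> 1\<close> copies of \<open>\<p> M\<close>, with projections \<open>tprj n i M\<close> for
  \<open>i < n\<close>.
\<close>

record ('o, 'a) tangent_rcat = "('o, 'a) cart_rcat" +
  tobj :: "'o \<Rightarrow> 'o"  ("\<T>\<index>")
  tmap :: "'a \<Rightarrow> 'a"  ("\<T>\<^sub>m\<index>")
  tpow :: "nat \<Rightarrow> 'o \<Rightarrow> 'o"
  tprj :: "nat \<Rightarrow> nat \<Rightarrow> 'o \<Rightarrow> 'a"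
  tproj :: "'o \<Rightarrow> 'a"  ("\<p>\<index>")
  tzero :: "'o \<Rightarrow> 'a"  ("\<zero>\<index>")
  tplus :: "'o \<Rightarrow> 'a"  ("\<s>\<index>")
  tlift :: "'o \<Rightarrow> 'a"  ("\<l>\<index>")
  tflip :: "'o \<Rightarrow> 'a"  ("\<c>\<index>")

definition tangent_bundle :: "('o, 'a, 'z) tangent_rcat_scheme \<Rightarrow> 'o \<Rightarrow> ('o, 'a) fibred_monoid" where
  "tangent_bundle X M =
     \<lparr>bproj = \<p> M, bpow = (\<lambda>n. tpow X n M), bprj = (\<lambda>n i. tprj X n i M),
      bplus = \<s> M, bzero = \<zero> M\<rparr>" for X (structure)

definition tmap_bundle ::
    "('o, 'a, 'z) tangent_rcat_scheme \<Rightarrow> ('o, 'a) fibred_monoid \<Rightarrow> ('o, 'a) fibred_monoid" where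
  "tmap_bundle X b =
     \<lparr>bproj = \<T>\<^sub>m (bproj b), bpow = (\<lambda>n. \<T> (bpow b n)), bprj = (\<lambda>n i. \<T>\<^sub>m (bprj b n i)),
      bplus = \<T>\<^sub>m (bplus b), bzero = \<T>\<^sub>m (bzero b)\<rparr>" for X (structure)

definition tpow2_map :: "('o, 'a, 'z) tangent_rcat_scheme \<Rightarrow> 'a \<Rightarrow> 'a" where
  "tpow2_map X f =
     bundle_pair X (tangent_bundle X (Cod X f))
       (tprj X 2 0 (Dom X f) \<cdot> \<T>\<^sub>m f) (tprj X 2 1 (Dom X f) \<cdot> \<T>\<^sub>m f)" for X (structure)

locale cartesian_tangent_join_restriction_category =
  join_restriction_category X + cartesian_restriction_category X
  for X :: "('o, 'a, 'z) tangent_rcat_scheme" (structure) +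
  assumes tobj_Obj: "M \<in> Obj X \<Longrightarrow> \<T> M \<in> Obj X"
    and tmap_hom: "f \<in> hom X A B \<Longrightarrow> \<T>\<^sub>m f \<in> hom X (\<T> A) (\<T> B)"
    and tmap_ident: "A \<in> Obj X \<Longrightarrow> \<T>\<^sub>m (\<one> A) = \<one> (\<T> A)"
    and tmap_cmp: "\<lbrakk>f \<in> hom X A B; g \<in> hom X B C\<rbrakk> \<Longrightarrow> \<T>\<^sub>m (f \<cdot> g) = \<T>\<^sub>m f \<cdot> \<T>\<^sub>m g"
    and tmap_rst: "f \<in> hom X A B \<Longrightarrow> \<T>\<^sub>m (\<rho> f) = \<rho> (\<T>\<^sub>m f)"
    and tobj_term_obj: "restriction_terminal X (\<T> (term_obj X))"
    and tobj_prd: "\<lbrakk>A \<in> Obj X; B \<in> Obj X\<rbrakk> \<Longrightarrow>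
          restriction_product X (\<T> A) (\<T> B) (\<T> (A \<otimes> B)) (\<T>\<^sub>m (\<pi>\<^sub>0 A B)) (\<T>\<^sub>m (\<pi>\<^sub>1 A B))"

    and tproj_hom: "M \<in> Obj X \<Longrightarrow> \<p> M \<in> total_hom X (\<T> M) M"
    and tzero_hom: "M \<in> Obj X \<Longrightarrow> \<zero> M \<in> total_hom X M (\<T> M)"
    and tplus_hom: "M \<in> Obj X \<Longrightarrow> \<s> M \<in> total_hom X (tpow X 2 M) (\<T> M)"
    and tlift_hom: "M \<in> Obj X \<Longrightarrow> \<l> M \<in> total_hom X (\<T> M) (\<T> (\<T> M))"
    and tflip_hom: "M \<in> Obj X \<Longrightarrow> \<c> M \<in> total_hom X (\<T> (\<T> M)) (\<T> (\<T> M))"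

    and tpow_pullback: "\<lbrakk>M \<in> Obj X; n \<ge> 1\<rbrakk> \<Longrightarrow>
          restriction_pullback_power X n (\<p> M) (tpow X n M) (\<lambda>i. tprj X n i M)"
    and tpow_preserved: "\<lbrakk>M \<in> Obj X; n \<ge> 1\<rbrakk> \<Longrightarrow>
          restriction_pullback_power X n ((\<T>\<^sub>m ^^ k) (\<p> M)) ((\<T> ^^ k) (tpow X n M))
            (\<lambda>i. (\<T>\<^sub>m ^^ k) (tprj X n i M))"

    and tproj_natural: "f \<in> hom X A B \<Longrightarrow> \<T>\<^sub>m f \<cdot> \<p> B = \<p> A \<cdot> f"
    and tzero_natural: "f \<in> hom X A B \<Longrightarrow> f \<cdot> \<zero> B = \<zero> A \<cdot> \<T>\<^sub>m f"
    and tplus_natural: "f \<in> hom X A B \<Longrightarrow> tpow2_map X f \<cdot> \<s> B = \<s> A \<cdot> \<T>\<^sub>m f"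
    and tlift_natural: "f \<in> hom X A B \<Longrightarrow> \<T>\<^sub>m f \<cdot> \<l> B = \<l> A \<cdot> \<T>\<^sub>m (\<T>\<^sub>m f)"
    and tflip_natural: "f \<in> hom X A B \<Longrightarrow> \<T>\<^sub>m (\<T>\<^sub>m f) \<cdot> \<c> B = \<c> A \<cdot> \<T>\<^sub>m (\<T>\<^sub>m f)"

    and tangent_additive: "M \<in> Obj X \<Longrightarrow> additive_bundle X (tangent_bundle X M)"
    and tlift_additive: "M \<in> Obj X \<Longrightarrow>
          additive_bundle_morphism X (tangent_bundle X M) (tmap_bundle X (tangent_bundle X M))
            (\<l> M) (\<zero> M)"
    and tflip_additive: "M \<in> Obj X \<Longrightarrow>
          additive_bundle_morphism X (tmap_bundle X (tangent_bundle X M)) (tangent_bundle X (\<T> M))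
            (\<c> M) (\<one> (\<T> M))"

    and tflip_tflip: "M \<in> Obj X \<Longrightarrow> \<c> M \<cdot> \<c> M = \<one> (\<T> (\<T> M))"
    and tlift_tflip: "M \<in> Obj X \<Longrightarrow> \<l> M \<cdot> \<c> M = \<l> M"
    and tlift_tlift: "M \<in> Obj X \<Longrightarrow> \<l> M \<cdot> \<T>\<^sub>m (\<l> M) = \<l> M \<cdot> \<l> (\<T> M)"
    and tflip_braid: "M \<in> Obj X \<Longrightarrow>
          \<T>\<^sub>m (\<c> M) \<cdot> \<c> (\<T> M) \<cdot> \<T>\<^sub>m (\<c> M) = \<c> (\<T> M) \<cdot> \<T>\<^sub>m (\<c> M) \<cdot> \<c> (\<T> M)"
    and tlift_tflip_tflip: "M \<in> Obj X \<Longrightarrow>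
          \<l> (\<T> M) \<cdot> \<T>\<^sub>m (\<c> M) \<cdot> \<c> (\<T> M) = \<c> M \<cdot> \<T>\<^sub>m (\<l> M)"

    and tlift_universal: "M \<in> Obj X \<Longrightarrow>
          restriction_pullback X (\<T>\<^sub>m (\<p> M)) (\<zero> M) (tpow X 2 M)
            (bundle_add X (tmap_bundle X (tangent_bundle X M))
              (tprj X 2 0 M \<cdot> \<l> M) (tprj X 2 1 M \<cdot> \<zero> (\<T> M)))
            (tprj X 2 0 M \<cdot> \<p> M)"


section \<open>Group objects and principal bundles\<close>

locale group_object = cartesian_restriction_category X
  for X :: "('o, 'a, 'z) cart_rcat_scheme" (structure) and G m u \<iota> +
  assumes G_Obj: "G \<in> Obj X"
    and mult_hom: "m \<in> total_hom X (G \<otimes> G) G"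
    and unit_hom: "u \<in> total_hom X (term_obj X) G"
    and inv_hom: "\<iota> \<in> total_hom X G G"
    and mult_assoc:
      "\<langle>\<pi>\<^sub>0 (G \<otimes> G) G \<cdot> m, \<pi>\<^sub>1 (G \<otimes> G) G\<rangle> \<cdot> m =
       \<langle>\<pi>\<^sub>0 (G \<otimes> G) G \<cdot> \<pi>\<^sub>0 G G, \<langle>\<pi>\<^sub>0 (G \<otimes> G) G \<cdot> \<pi>\<^sub>1 G G, \<pi>\<^sub>1 (G \<otimes> G) G\<rangle> \<cdot> m\<rangle> \<cdot> m"
    and unit_mult: "\<langle>bang X G \<cdot> u, \<one> G\<rangle> \<cdot> m = \<one> G"
    and mult_unit: "\<langle>\<one> G, bang X G \<cdot> u\<rangle> \<cdot> m = \<one> G"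
    and inv_mult: "\<langle>\<iota>, \<one> G\<rangle> \<cdot> m = bang X G \<cdot> u"
    and mult_inv: "\<langle>\<one> G, \<iota>\<rangle> \<cdot> m = bang X G \<cdot> u"

locale fibre_bundle = join_restriction_category X + cartesian_restriction_category X
  for X :: "('o, 'a, 'z) cart_rcat_scheme" (structure)
    and M F E q and I :: "'i set" and \<alpha> :: "'i \<Rightarrow> 'a" +
  assumes base_Obj: "M \<in> Obj X"
    and fibre_Obj: "F \<in> Obj X"
    and q_hom: "q \<in> total_hom X E M"
    and chart_hom: "i \<in> I \<Longrightarrow> \<alpha> i \<in> hom X E (M \<otimes> F)"
    and chart_partial_iso: "i \<in> I \<Longrightarrow> partial_isomorphism X (\<alpha> i)"
    and chart_prj0: "i \<in> I \<Longrightarrow> \<alpha> i \<cdot> \<pi>\<^sub>0 M F = \<rho> (\<alpha> i) \<cdot> q"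
    and charts_cover: "is_join X E E ((\<lambda>i. \<rho> (\<alpha> i)) ` I) (\<one> E)"
    and chart_image: "i \<in> I \<Longrightarrow> \<exists>e \<in> hom X M M. restriction_idempotent X e \<and>
          \<rho> (partial_inverse X (\<alpha> i)) = prd_map X e (\<one> F)"

locale group_atlas = group_object X G m u \<iota>
  for X :: "('o, 'a, 'z) cart_rcat_scheme" (structure) and G m u \<iota>
    and M and I :: "'i set" and \<tau> :: "'i \<Rightarrow> 'i \<Rightarrow> 'a" +
  assumes atlas_base_Obj: "M \<in> Obj X"
    and atlas_hom: "\<lbrakk>i \<in> I; j \<in> I\<rbrakk> \<Longrightarrow> \<tau> i j \<in> hom X M G"
    and atlas_cocycle: "\<lbrakk>i \<in> I; j \<in> I; k \<in> I\<rbrakk> \<Longrightarrow> \<langle>\<tau> i j, \<tau> j k\<rangle> \<cdot> m \<preceq> \<tau> i k"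
    and atlas_unit: "i \<in> I \<Longrightarrow> \<tau> i i \<preceq> bang X M \<cdot> u"
    and atlas_inv: "\<lbrakk>i \<in> I; j \<in> I\<rbrakk> \<Longrightarrow> \<tau> j i = \<tau> i j \<cdot> \<iota>"

locale principal_bundle =
  group_atlas X G m u \<iota> M I \<tau> + fibre_bundle X M G P q I \<alpha>
  for X :: "('o, 'a, 'z) cart_rcat_scheme" (structure) and G m u \<iota> M P q
    and I :: "'i set" and \<alpha> \<tau> +
  assumes transition: "\<lbrakk>i \<in> I; j \<in> I\<rbrakk> \<Longrightarrow>
          partial_inverse X (\<alpha> i) \<cdot> \<alpha> j =
            \<langle>\<pi>\<^sub>0 M G, \<langle>\<pi>\<^sub>0 M G \<cdot> \<tau> j i, \<pi>\<^sub>1 M G\<rangle> \<cdot> m\<rangle>"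

end

theory Submission
  imports Defs
begin

text \<open>
  The vertical bundle is trivialised by differentiating the action of \<open>G\<close>. The transition maps
  multiply on the left, so right multiplication in the charts does not depend on the chart and
  glues to a total action \<open>\<a> : P \<otimes> G \<rightarrow> P\<close> over \<open>M\<close> (\<open>action_exists\<close>). A pair of a point \<open>x\<close> of
  \<open>P\<close> and a tangent vector \<open>k\<close> at the unit of \<open>G\<close> is sent to the tangent vector
  \<open>\<T>\<^sub>m \<a> (0\<^sub>x, k)\<close> at \<open>x\<close>, which is vertical because \<open>\<a>\<close> preserves the fibres of \<open>q\<close>.

  Why every vertical vector arises from exactly one such pair: two elements \<open>x, b\<close> of \<open>\<T> P\<close> with
  the same image under \<open>\<T>\<^sub>m q\<close> and the same base point in \<open>P\<close> satisfy \<open>b = \<T>\<^sub>m \<a> (x, k)\<close> for a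
  unique \<open>k\<close> in \<open>\<T> G\<close> (\<open>tangent_action_free\<close>, \<open>tangent_action_transitive\<close>). In a chart, \<open>k\<close> is
  the quotient of the two fibre coordinates, which exists since \<open>(g, h) \<mapsto> (g, gh)\<close> is invertible
  and \<open>\<T>\<close>, being a functor, keeps it invertible; uniqueness makes the local quotients agree on
  overlaps, so they glue. A vertical vector \<open>b\<close> at the point \<open>p b\<close> has the same image under
  \<open>\<T>\<^sub>m q\<close> as \<open>x = 0\<^bsub>p b\<^esub>\<close>. Projecting \<open>b = \<T>\<^sub>m \<a> (0\<^bsub>p b\<^esub>, k)\<close> to \<open>P\<close> gives
  \<open>p b = \<a> (p b, p k)\<close>, so freeness of the action makes \<open>p k\<close> the unit, and \<open>k\<close> is an element of
  the restriction pullback \<open>\<T>(G)\<^sub>u\<close>. This is the universal property of the vertical bundle for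
  \<open>P \<otimes> \<T>(G)\<^sub>u\<close> (\<open>vertical_bundle_pullback\<close>); any other vertical bundle is isomorphic to it since
  restriction pullbacks are unique up to isomorphism.

  Equal base points cannot be dropped, because a chart need not be defined on whole fibres of \<open>q\<close>:
  two disjoint copies of \<open>G\<close> over a one-point base, each with its own chart and with nowhere
  defined transition maps between them, may form a principal bundle, and no element of \<open>G\<close> moves
  one copy to the other. A common base point forces \<open>x\<close> and \<open>b\<close> into the same charts, since
  the domain of \<open>\<T>\<^sub>m f\<close> consists of the tangent vectors based in the domain of \<open>f\<close>
  (\<open>rst_cmp_tmap\<close>). This also shows that the tangent charts cover \<open>\<T> P\<close>, although \<open>\<T>\<close> is not
  assumed to preserve joins.

  Arguments are made with generalised elements, that is, partial maps from an arbitrary object.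
  Composability is expressed by equations between domains and codomains, which rewriting can
  discharge.
\<close>

section \<open>Restriction categories\<close>

context category
begin

lemma hom_iff: "f \<in> hom X A B \<longleftrightarrow> f \<in> Arr X \<and> Dom X f = A \<and> Cod X f = B"
  by (auto simp: hom_def)

lemma arr_ident [simp]: "A \<in> Obj X \<Longrightarrow> \<one> A \<in> Arr X"
  and dom_ident [simp]: "A \<in> Obj X \<Longrightarrow> Dom X (\<one> A) = A"
  and cod_ident [simp]: "A \<in> Obj X \<Longrightarrow> Cod X (\<one> A) = A"
  using ident_hom by (auto simp: hom_iff)

lemma cmp_typing [simp]:
  assumes "f \<in> Arr X" "g \<in> Arr X" "Cod X f = Dom X g"
  shows "f \<cdot> g \<in> Arr X" "Dom X (f \<cdot> g) = Dom X f" "Cod X (f \<cdot> g) = Cod X g"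
  using cmp_hom[of f "Dom X f" "Cod X f" g "Cod X g"] assms by (auto simp: hom_iff)

lemma ident_left [simp]: "f \<in> Arr X \<Longrightarrow> Dom X f = A \<Longrightarrow> \<one> A \<cdot> f = f"
  using ident_cmp by (auto simp: hom_iff)

lemma ident_right [simp]: "f \<in> Arr X \<Longrightarrow> Cod X f = A \<Longrightarrow> f \<cdot> \<one> A = f"
  using cmp_ident by (auto simp: hom_iff)

lemma assoc [simp]:
  "\<lbrakk>f \<in> Arr X; g \<in> Arr X; h \<in> Arr X; Cod X f = Dom X g; Cod X g = Dom X h\<rbrakk>
     \<Longrightarrow> (f \<cdot> g) \<cdot> h = f \<cdot> (g \<cdot> h)"
  using cmp_assoc by (auto simp: hom_iff)

lemma cmp_extend:
  "\<lbrakk>f \<cdot> g = k; f \<in> Arr X; g \<in> Arr X; h \<in> Arr X; Cod X f = Dom X g; Cod X g = Dom X h\<rbrakk>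
     \<Longrightarrow> f \<cdot> (g \<cdot> h) = k \<cdot> h"
  using assoc by metis

lemma Dom_in_Obj [simp]: "f \<in> Arr X \<Longrightarrow> Dom X f \<in> Obj X"
  and Cod_in_Obj [simp]: "f \<in> Arr X \<Longrightarrow> Cod X f \<in> Obj X"
  by (auto intro: Dom_Obj Cod_Obj)

end

context restriction_category
begin

lemma rst_typing [simp]:
  assumes "f \<in> Arr X"
  shows "\<rho> f \<in> Arr X" "Dom X (\<rho> f) = Dom X f" "Cod X (\<rho> f) = Dom X f"
  using rst_hom[of f "Dom X f" "Cod X f"] assms by (auto simp: hom_iff)

lemma rst_self [simp]: "f \<in> Arr X \<Longrightarrow> \<rho> f \<cdot> f = f"
  using rst_cmp_self by (auto simp: hom_iff)

lemma rst_self_extend [simp]: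
  "\<lbrakk>f \<in> Arr X; g \<in> Arr X; Cod X f = Dom X g\<rbrakk> \<Longrightarrow> \<rho> f \<cdot> (f \<cdot> g) = f \<cdot> g"
  by (rule cmp_extend) auto

lemma rst_comm:
  "\<lbrakk>f \<in> Arr X; g \<in> Arr X; Dom X f = Dom X g\<rbrakk> \<Longrightarrow> \<rho> f \<cdot> \<rho> g = \<rho> g \<cdot> \<rho> f"
  using rst_commute by (auto simp: hom_iff)

lemma rst_rst_left [simp]:
  "\<lbrakk>f \<in> Arr X; g \<in> Arr X; Dom X f = Dom X g\<rbrakk> \<Longrightarrow> \<rho> (\<rho> g \<cdot> f) = \<rho> g \<cdot> \<rho> f"
  using rst_rst_cmp by (auto simp: hom_iff)

lemma cmp_rst_swap:
  "\<lbrakk>f \<in> Arr X; h \<in> Arr X; Cod X f = Dom X h\<rbrakk> \<Longrightarrow> f \<cdot> \<rho> h = \<rho> (f \<cdot> h) \<cdot> f"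
  using cmp_rst by (auto simp: hom_iff)

lemma rst_ident [simp]: "A \<in> Obj X \<Longrightarrow> \<rho> (\<one> A) = \<one> A"
  using rst_self[of "\<one> A"] ident_right[of "\<rho> (\<one> A)" A] by simp

lemma rst_idem [simp]: "f \<in> Arr X \<Longrightarrow> \<rho> (\<rho> f) = \<rho> f"
  using rst_rst_left[of "\<one> (Dom X f)" f] by simp

lemma rst_rst_self [simp]: "f \<in> Arr X \<Longrightarrow> \<rho> f \<cdot> \<rho> f = \<rho> f"
  using rst_self[of "\<rho> f"] by simp

lemma rst_rst_extend [simp]:
  "\<lbrakk>f \<in> Arr X; g \<in> Arr X; Dom X f = Dom X g\<rbrakk> \<Longrightarrow> \<rho> f \<cdot> (\<rho> f \<cdot> g) = \<rho> f \<cdot> g"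
  using cmp_extend[OF rst_rst_self[of f], of g] by simp

lemma rst_cmp_le [simp]:
  assumes "f \<in> Arr X" "g \<in> Arr X" "Cod X f = Dom X g"
  shows "\<rho> f \<cdot> \<rho> (f \<cdot> g) = \<rho> (f \<cdot> g)"
  using rst_rst_left[of "f \<cdot> g" f] assms by simp

lemma rst_cmp_le' [simp]:
  assumes "f \<in> Arr X" "g \<in> Arr X" "Cod X f = Dom X g"
  shows "\<rho> (f \<cdot> g) \<cdot> \<rho> f = \<rho> (f \<cdot> g)"
  using rst_comm[of "f \<cdot> g" f] assms by simp

lemma rst_cmp_rst [simp]:
  assumes "f \<in> Arr X" "g \<in> Arr X" "Cod X f = Dom X g"
  shows "\<rho> (f \<cdot> \<rho> g) = \<rho> (f \<cdot> g)"
proof -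
  have "\<rho> (f \<cdot> \<rho> g) = \<rho> (\<rho> (f \<cdot> g) \<cdot> f)" using cmp_rst_swap[of f g] assms by simp
  also have "\<dots> = \<rho> (f \<cdot> g)" using assms by simp
  finally show ?thesis .
qed

lemma totalD: "total X f \<Longrightarrow> \<rho> f = \<one> (Dom X f)"
  by (simp add: total_def)

lemma rst_cmp_total [simp]:
  assumes "total X g" "f \<in> Arr X" "g \<in> Arr X" "Cod X f = Dom X g"
  shows "\<rho> (f \<cdot> g) = \<rho> f"
  using rst_cmp_rst[of f g] assms totalD[of g] by simp

lemma total_cmp [simp]:
  "\<lbrakk>total X f; total X g; f \<in> Arr X; g \<in> Arr X; Cod X f = Dom X g\<rbrakk> \<Longrightarrow> total X (f \<cdot> g)"
  by (simp add: total_def[of X "f \<cdot> g"] totalD)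

lemma total_ident [simp]: "A \<in> Obj X \<Longrightarrow> total X (\<one> A)"
  by (simp add: total_def)

lemma total_hom_iff:
  "f \<in> total_hom X A B \<longleftrightarrow> f \<in> Arr X \<and> Dom X f = A \<and> Cod X f = B \<and> total X f"
  by (auto simp: total_hom_def hom_iff)

lemma restrict_to_domain:
  assumes "\<rho> (x \<cdot> f) = \<rho> x" "x \<in> Arr X" "f \<in> Arr X" "Cod X x = Dom X f"
  shows "x \<cdot> \<rho> f = x"
  using cmp_rst_swap[of x f] assms by simp

lemma is_partial_inverseD:
  assumes "is_partial_inverse X f g" 
  shows "f \<in> Arr X" "g \<in> Arr X" "Dom X g = Cod X f" "Cod X g = Dom X f"
    "f \<cdot> g = \<rho> f" "g \<cdot> f = \<rho> g"
  using assms by (auto simp: is_partial_inverse_def hom_iff)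

lemma is_partial_inverse_unique:
  assumes "is_partial_inverse X f g" "is_partial_inverse X f h"
  shows "g = h"
proof -
  note G = is_partial_inverseD[OF assms(1)] and H = is_partial_inverseD[OF assms(2)]
  have below: "\<rho> a \<cdot> b = a" if "is_partial_inverse X f a" "is_partial_inverse X f b" for a b
  proof -
    note A = is_partial_inverseD[OF that(1)] and B = is_partial_inverseD[OF that(2)]
    have "\<rho> a \<cdot> b = a \<cdot> f \<cdot> b" using A by simp
    also have "\<dots> = a \<cdot> (f \<cdot> b)" using A(1-4) B(1-4) by simp
    also have "\<dots> = a \<cdot> \<rho> f" using B by simp
    also have "\<dots> = a" using A cmp_rst_swap[of a f] by simp
    finally show ?thesis .
  qed
  have "g = \<rho> g \<cdot> (\<rho> h \<cdot> g)" using below[OF assms] below[OF assms(2,1)] by simp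
  also have "\<dots> = \<rho> h \<cdot> (\<rho> g \<cdot> g)"
    using G H rst_comm[of g h] assoc[of "\<rho> g" "\<rho> h" g] assoc[of "\<rho> h" "\<rho> g" g] by simp
  also have "\<dots> = h" using G H below[OF assms(2,1)] by simp
  finally show ?thesis .
qed

lemma partial_inverse:
  assumes "partial_isomorphism X f"
  shows "is_partial_inverse X f (partial_inverse X f)"
proof -
  obtain g where g: "is_partial_inverse X f g" using assms unfolding partial_isomorphism_def ..
  then show ?thesis
    unfolding partial_inverse_def by (rule theI) (rule is_partial_inverse_unique[OF _ g])
qed

text \<open>Two pullbacks of the same cospan receive comparison maps from each other's projections.\<close>

lemma restriction_pullback_unique:
  assumes V: "restriction_pullback X f g V v w" and W: "restriction_pullback X f g W v' w'"
  shows "isomorphic X V W"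
proof -
  have *: "\<exists>k \<in> hom X V' W'. k \<cdot> c = a \<and> k \<cdot> d = b"
    if "restriction_pullback X f g V' a b" "restriction_pullback X f g W' c d" for V' W' a b c d
  proof -
    have "a \<in> hom X V' (Dom X f)" "b \<in> hom X V' (Dom X g)" "a \<cdot> f = b \<cdot> g"
      using that(1) by (auto simp: restriction_pullback_def total_hom_def)
    then have "\<exists>!h. h \<in> hom X V' W' \<and> h \<cdot> c = a \<and> h \<cdot> d = b"
      using that(2) unfolding restriction_pullback_def by blast
    then show ?thesis by blast
  qed
  have **: "k = \<one> V'"
    if "restriction_pullback X f g V' a b" "k \<in> hom X V' V'" "k \<cdot> a = a" "k \<cdot> b = b"
    for V' a b k
  proof -
    have V': "V' \<in> Obj X" using that(2) by (auto simp: hom_iff)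
    have a: "a \<in> hom X V' (Dom X f)" "b \<in> hom X V' (Dom X g)" "a \<cdot> f = b \<cdot> g"
      using that(1) by (auto simp: restriction_pullback_def total_hom_def)
    have "\<exists>!h. h \<in> hom X V' V' \<and> h \<cdot> a = a \<and> h \<cdot> b = b"
      using that(1) a unfolding restriction_pullback_def by blast
    moreover have "\<one> V' \<in> hom X V' V' \<and> \<one> V' \<cdot> a = a \<and> \<one> V' \<cdot> b = b"
      using V' a by (auto simp: hom_iff)
    ultimately show ?thesis using that(2-4) by blast
  qed
  have A: "v \<in> Arr X" "w \<in> Arr X" "v' \<in> Arr X" "w' \<in> Arr X"
     "Dom X v = V" "Dom X w = V" "Dom X v' = W" "Dom X w' = W"
    using V W by (auto simp: restriction_pullback_def total_hom_iff)
  obtain h where h: "h \<in> hom X V W" "h \<cdot> v' = v" "h \<cdot> w' = w" using *[OF V W] by auto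
  obtain k where k: "k \<in> hom X W V" "k \<cdot> v = v'" "k \<cdot> w = w'" using *[OF W V] by auto
  have "h \<cdot> k = \<one> V" using h k A by (intro **[OF V]) (auto simp: hom_iff)
  moreover have "k \<cdot> h = \<one> W" using h k A by (intro **[OF W]) (auto simp: hom_iff)
  ultimately show ?thesis using h(1) k(1) unfolding isomorphic_def by blast
qed

lemma restriction_product_ext:
  assumes Y: "restriction_product X A B Y r s"
    and h: "h \<in> Arr X" "k \<in> Arr X" "Dom X h = Dom X k" "Cod X h = Y" "Cod X k = Y"
    and eq: "h \<cdot> r = k \<cdot> r" "h \<cdot> s = k \<cdot> s"
  shows "h = k"
proof -
  have P: "r \<in> Arr X" "s \<in> Arr X" "Dom X r = Y" "Dom X s = Y" "Cod X r = A" "Cod X s = B"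
    "total X r" "total X s"
    using Y by (auto simp: restriction_product_def total_hom_iff)
  have "\<exists>!l. l \<in> hom X (Dom X h) Y \<and> l \<cdot> r = \<rho> (h \<cdot> s) \<cdot> (h \<cdot> r) \<and> l \<cdot> s = \<rho> (h \<cdot> r) \<cdot> (h \<cdot> s)"
  proof -
    have "h \<cdot> r \<in> hom X (Dom X h) A" "h \<cdot> s \<in> hom X (Dom X h) B"
      using P h by (auto simp: hom_iff)
    then show ?thesis using Y unfolding restriction_product_def by blast
  qed
  moreover have "\<rho> k = \<rho> h" using P h eq rst_cmp_total[of r h] rst_cmp_total[of r k] by simp
  moreover have "h \<in> hom X (Dom X h) Y" "k \<in> hom X (Dom X h) Y" using h by (auto simp: hom_iff)
  moreover have "\<rho> (h \<cdot> s) \<cdot> (h \<cdot> r) = h \<cdot> r" "\<rho> (h \<cdot> r) \<cdot> (h \<cdot> s) = h \<cdot> s"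
    using P h by simp_all
  ultimately show ?thesis using eq by metis
qed

text \<open>For maps with the same domain of definition the restriction pairing has the two maps
  themselves as components, as in an ordinary product.\<close>

lemma restriction_product_pair:
  assumes Y: "restriction_product X A B Y r s"
    and f: "f \<in> Arr X" "g \<in> Arr X" "Dom X f = Dom X g" "Cod X f = A" "Cod X g = B" "\<rho> f = \<rho> g"
  obtains h where "h \<in> Arr X" "Dom X h = Dom X f" "Cod X h = Y" "h \<cdot> r = f" "h \<cdot> s = g" "\<rho> h = \<rho> f"
proof -
  have P: "r \<in> Arr X" "Dom X r = Y" "total X r"
    using Y by (auto simp: restriction_product_def total_hom_iff)
  obtain h where h: "h \<in> hom X (Dom X f) Y" "h \<cdot> r = \<rho> g \<cdot> f" "h \<cdot> s = \<rho> f \<cdot> g"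
  proof -
    have "f \<in> hom X (Dom X f) A" "g \<in> hom X (Dom X f) B" using f by (auto simp: hom_iff)
    then show ?thesis using Y that unfolding restriction_product_def by blast
  qed
  then have "h \<cdot> r = f" "h \<cdot> s = g" using f rst_self[of f] rst_self[of g] by auto
  moreover have "\<rho> h = \<rho> f" using rst_cmp_total[of r h] P h calculation by (auto simp: hom_iff)
  ultimately show ?thesis using that h by (auto simp: hom_iff)
qed

end

section \<open>Joins\<close>

context join_restriction_category
begin

lemma rle_antisym:
  assumes "f \<in> hom X A B" "g \<in> hom X A B" "f \<preceq> g" "g \<preceq> f"
  shows "f = g"
proof -
  have T: "f \<in> Arr X" "g \<in> Arr X" "Dom X f = Dom X g" using assms by (auto simp: hom_iff)
  have f: "\<rho> f \<cdot> g = f" and g: "\<rho> g \<cdot> f = g" using assms by (auto simp: rle_def)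
  have "f = \<rho> f \<cdot> (\<rho> g \<cdot> f)" using f g by simp
  also have "\<dots> = \<rho> g \<cdot> (\<rho> f \<cdot> f)"
    using T rst_comm[of f g] assoc[of "\<rho> f" "\<rho> g" f] assoc[of "\<rho> g" "\<rho> f" f] by simp
  finally show ?thesis using g T by simp
qed

lemma is_join_unique: "is_join X A B S s \<Longrightarrow> is_join X A B S t \<Longrightarrow> s = t"
  unfolding is_join_def by (meson rle_antisym)

lemma glue:
  assumes cov: "is_join X A A ((\<lambda>i. \<rho> (f i)) ` I) e"
    and B: "A \<in> Obj X" "B \<in> Obj X"
    and f: "\<And>i. i \<in> I \<Longrightarrow> f i \<in> hom X A B"
    and compat: "\<And>i j. i \<in> I \<Longrightarrow> j \<in> I \<Longrightarrow> \<rho> (f i) \<cdot> f j = \<rho> (f j) \<cdot> f i"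
  obtains g where "g \<in> hom X A B" "\<rho> g = e" "\<And>i. i \<in> I \<Longrightarrow> \<rho> (f i) \<cdot> g = f i"
proof -
  obtain g where g: "is_join X A B (f ` I) g"
    using join_exists[OF B, of "f ` I"] f compat by (auto simp: compatible_def)
  have "is_join X A A ((\<lambda>i. \<rho> (f i)) ` I) (\<rho> g)"
    using rst_join[OF g] by (simp add: image_image)
  then have "\<rho> g = e" using cov is_join_unique by blast
  then show ?thesis using g by (intro that[of g]) (auto simp: is_join_def rle_def)
qed

text \<open>The common map is the join of its restrictions: both \<open>f\<close> and \<open>g\<close> lie above the join of the
  family \<open>e i \<cdot> f\<close>, and that join is already defined wherever they are.\<close>

lemma local_eq:
  assumes cov: "is_join X A A (e ` I) d"
    and idem: "\<And>i. i \<in> I \<Longrightarrow> \<rho> (e i) = e i"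
    and f: "f \<in> hom X A B" "g \<in> hom X A B" "\<rho> f = d" "\<rho> g = d"
    and eq: "\<And>i. i \<in> I \<Longrightarrow> e i \<cdot> f = e i \<cdot> g"
  shows "f = g"
proof -
  have T: "f \<in> Arr X" "Dom X f = A" "Cod X f = B" "g \<in> Arr X" "Dom X g = A" "Cod X g = B" 
    using f by (auto simp: hom_iff)
  have e: "e i \<in> Arr X" "Dom X (e i) = A" "Cod X (e i) = A" if "i \<in> I" for i
    using cov that by (auto simp: is_join_def hom_iff)
  have le: "e i \<cdot> d = e i" if "i \<in> I" for i
    using cov that idem by (auto simp: is_join_def rle_def)
  have r: "\<rho> (e i \<cdot> f) = e i" if "i \<in> I" for i
    using rst_rst_left[of f "e i"] e[OF that] T f(3) le[OF that] idem[OF that] by simp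
  have cov': "is_join X A A ((\<lambda>i. \<rho> (e i \<cdot> f)) ` I) d"
    using cov r by (simp cong: image_cong)
  have comm: "e i \<cdot> (e j \<cdot> f) = e j \<cdot> (e i \<cdot> f)" if "i \<in> I" "j \<in> I" for i j
    using e[OF that(1)] e[OF that(2)] T rst_comm[of "e i" "e j"] idem that
      assoc[of "e i" "e j" f] assoc[of "e j" "e i" f] by simp
  have A: "A \<in> Obj X" "B \<in> Obj X" using T(1-3) by auto
  have *: "s = h" if s: "is_join X A B ((\<lambda>i. e i \<cdot> f) ` I) s"
    and h: "h \<in> hom X A B" "\<rho> h = d" "\<And>i. i \<in> I \<Longrightarrow> e i \<cdot> h = e i \<cdot> f" for s h
  proof -
    have "is_join X A A ((\<lambda>i. \<rho> (e i \<cdot> f)) ` I) (\<rho> s)"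
      using rst_join[OF s] by (simp add: image_image)
    then have "\<rho> s = d" using cov' is_join_unique by blast
    moreover have "s \<preceq> h"
      using s h r unfolding is_join_def by (auto simp: rle_def)
    ultimately have "\<rho> h \<cdot> h = s" using h by (simp add: rle_def)
    then show ?thesis using h(1) rst_self[of h] by (auto simp: hom_iff)
  qed
  obtain s where "is_join X A B ((\<lambda>i. e i \<cdot> f) ` I) s"
  proof -
    have "(\<lambda>i. e i \<cdot> f) ` I \<subseteq> hom X A B" using e T by (auto simp: hom_iff)
    moreover have "\<forall>h \<in> (\<lambda>i. e i \<cdot> f) ` I. \<forall>k \<in> (\<lambda>i. e i \<cdot> f) ` I. h \<smile> k"
      using r comm by (auto simp: compatible_def)
    ultimately show ?thesis using join_exists[OF A] that by blast
  qed
  then show ?thesis using *[OF _ f(1,3)] *[OF _ f(2,4)] eq by metis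
qed

end

section \<open>Restriction products\<close>

context cartesian_restriction_category
begin

lemma prd_typing [simp]:
  assumes "A \<in> Obj X" "B \<in> Obj X"
  shows "A \<otimes> B \<in> Obj X"
    "\<pi>\<^sub>0 A B \<in> Arr X" "Dom X (\<pi>\<^sub>0 A B) = A \<otimes> B" "Cod X (\<pi>\<^sub>0 A B) = A" "total X (\<pi>\<^sub>0 A B)"
    "\<pi>\<^sub>1 A B \<in> Arr X" "Dom X (\<pi>\<^sub>1 A B) = A \<otimes> B" "Cod X (\<pi>\<^sub>1 A B) = B" "total X (\<pi>\<^sub>1 A B)"
proof -
  show *: "\<pi>\<^sub>0 A B \<in> Arr X" "Dom X (\<pi>\<^sub>0 A B) = A \<otimes> B" "Cod X (\<pi>\<^sub>0 A B) = A" "total X (\<pi>\<^sub>0 A B)"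
    "\<pi>\<^sub>1 A B \<in> Arr X" "Dom X (\<pi>\<^sub>1 A B) = A \<otimes> B" "Cod X (\<pi>\<^sub>1 A B) = B" "total X (\<pi>\<^sub>1 A B)"
    using prd_product[OF assms] by (auto simp: restriction_product_def total_hom_iff)
  show "A \<otimes> B \<in> Obj X" using Dom_in_Obj[OF *(1)] *(2) by simp
qed

lemma rpair_char:
  assumes "f \<in> Arr X" "g \<in> Arr X" "Dom X f = Dom X g"
  shows "\<langle>f, g\<rangle> \<in> hom X (Dom X f) (Cod X f \<otimes> Cod X g) \<and>
    \<langle>f, g\<rangle> \<cdot> \<pi>\<^sub>0 (Cod X f) (Cod X g) = \<rho> g \<cdot> f \<and> \<langle>f, g\<rangle> \<cdot> \<pi>\<^sub>1 (Cod X f) (Cod X g) = \<rho> f \<cdot> g"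
proof -
  have "f \<in> hom X (Dom X f) (Cod X f)" "g \<in> hom X (Dom X f) (Cod X g)"
    using assms by (auto simp: hom_iff)
  then have "\<exists>!h. h \<in> hom X (Dom X f) (Cod X f \<otimes> Cod X g) \<and>
    h \<cdot> \<pi>\<^sub>0 (Cod X f) (Cod X g) = \<rho> g \<cdot> f \<and> h \<cdot> \<pi>\<^sub>1 (Cod X f) (Cod X g) = \<rho> f \<cdot> g"
    using prd_product[of "Cod X f" "Cod X g"] Cod_in_Obj[OF assms(1)] Cod_in_Obj[OF assms(2)]
    unfolding restriction_product_def by blast
  from theI'[OF this] show ?thesis unfolding rpair_def .
qed

lemma rpair_typing [simp]:
  assumes "f \<in> Arr X" "g \<in> Arr X" "Dom X f = Dom X g"
  shows "\<langle>f, g\<rangle> \<in> Arr X" "Dom X \<langle>f, g\<rangle> = Dom X f" "Cod X \<langle>f, g\<rangle> = Cod X f \<otimes> Cod X g"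
  using rpair_char[OF assms] by (auto simp: hom_iff)

lemma rpair_prj [simp]:
  assumes "f \<in> Arr X" "g \<in> Arr X" "Dom X f = Dom X g" "Cod X f = A" "Cod X g = B"
  shows "\<langle>f, g\<rangle> \<cdot> \<pi>\<^sub>0 A B = \<rho> g \<cdot> f" "\<langle>f, g\<rangle> \<cdot> \<pi>\<^sub>1 A B = \<rho> f \<cdot> g"
  using rpair_char[OF assms(1-3)] assms(4,5) by auto

lemma rpair_prj_extend [simp]:
  assumes "f \<in> Arr X" "g \<in> Arr X" "Dom X f = Dom X g" "Cod X f = A" "Cod X g = B" "k \<in> Arr X"
  shows "Dom X k = A \<Longrightarrow> \<langle>f, g\<rangle> \<cdot> (\<pi>\<^sub>0 A B \<cdot> k) = \<rho> g \<cdot> (f \<cdot> k)"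
    "Dom X k = B \<Longrightarrow> \<langle>f, g\<rangle> \<cdot> (\<pi>\<^sub>1 A B \<cdot> k) = \<rho> f \<cdot> (g \<cdot> k)"
  using assms cmp_extend[OF rpair_prj(1)[OF assms(1-5)], of k]
    cmp_extend[OF rpair_prj(2)[OF assms(1-5)], of k] by auto

lemma rst_rpair [simp]:
  assumes "f \<in> Arr X" "g \<in> Arr X" "Dom X f = Dom X g"
  shows "\<rho> \<langle>f, g\<rangle> = \<rho> f \<cdot> \<rho> g"
proof -
  have "\<rho> \<langle>f, g\<rangle> = \<rho> (\<langle>f, g\<rangle> \<cdot> \<pi>\<^sub>1 (Cod X f) (Cod X g))"
    using assms rst_cmp_total[of "\<pi>\<^sub>1 (Cod X f) (Cod X g)" "\<langle>f, g\<rangle>"] by simp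
  also have "\<dots> = \<rho> f \<cdot> \<rho> g" using assms by simp
  finally show ?thesis .
qed

lemma prd_ext:
  assumes "A \<in> Obj X" "B \<in> Obj X"
    and "h \<in> Arr X" "k \<in> Arr X" "Dom X h = Dom X k" "Cod X h = A \<otimes> B" "Cod X k = A \<otimes> B"
    and "h \<cdot> \<pi>\<^sub>0 A B = k \<cdot> \<pi>\<^sub>0 A B" "h \<cdot> \<pi>\<^sub>1 A B = k \<cdot> \<pi>\<^sub>1 A B"
  shows "h = k"
  using restriction_product_ext[OF prd_product[OF assms(1,2)]] assms(3-) by blast

lemma cmp_rpair [simp]:
  assumes "f \<in> Arr X" "g \<in> Arr X" "Dom X f = Dom X g" "h \<in> Arr X" "Cod X h = Dom X g"
  shows "h \<cdot> \<langle>f, g\<rangle> = \<langle>h \<cdot> f, h \<cdot> g\<rangle>"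
proof (rule prd_ext[of "Cod X f" "Cod X g"])
  have "h \<cdot> (\<rho> g \<cdot> f) = \<rho> (h \<cdot> g) \<cdot> (h \<cdot> f)" "h \<cdot> (\<rho> f \<cdot> g) = \<rho> (h \<cdot> f) \<cdot> (h \<cdot> g)"
    using assms cmp_extend[OF cmp_rst_swap[of h g], of f] cmp_extend[OF cmp_rst_swap[of h f], of g]
    by auto
  then show "h \<cdot> \<langle>f, g\<rangle> \<cdot> \<pi>\<^sub>0 (Cod X f) (Cod X g) = \<langle>h \<cdot> f, h \<cdot> g\<rangle> \<cdot> \<pi>\<^sub>0 (Cod X f) (Cod X g)"
    "h \<cdot> \<langle>f, g\<rangle> \<cdot> \<pi>\<^sub>1 (Cod X f) (Cod X g) = \<langle>h \<cdot> f, h \<cdot> g\<rangle> \<cdot> \<pi>\<^sub>1 (Cod X f) (Cod X g)"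
    using assms by simp_all
qed (use assms in simp_all)

lemma cmp_rpair_extend [simp]:
  assumes "f \<in> Arr X" "g \<in> Arr X" "Dom X f = Dom X g" "h \<in> Arr X" "Cod X h = Dom X g"
    "k \<in> Arr X" "Dom X k = Cod X f \<otimes> Cod X g"
  shows "h \<cdot> (\<langle>f, g\<rangle> \<cdot> k) = \<langle>h \<cdot> f, h \<cdot> g\<rangle> \<cdot> k"
  using cmp_extend[OF cmp_rpair[OF assms(1-5)], of k] assms by simp

lemma rpair_prjs [simp]:
  "A \<in> Obj X \<Longrightarrow> B \<in> Obj X \<Longrightarrow> \<langle>\<pi>\<^sub>0 A B, \<pi>\<^sub>1 A B\<rangle> = \<one> (A \<otimes> B)"
  by (rule prd_ext[of A B]) (simp_all add: totalD)

lemma rpair_eta: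
  "A \<in> Obj X \<Longrightarrow> B \<in> Obj X \<Longrightarrow> h \<in> Arr X \<Longrightarrow> Cod X h = A \<otimes> B \<Longrightarrow>
     \<langle>h \<cdot> \<pi>\<^sub>0 A B, h \<cdot> \<pi>\<^sub>1 A B\<rangle> = h"
  using cmp_rpair[of "\<pi>\<^sub>0 A B" "\<pi>\<^sub>1 A B" h] by simp

lemma term_obj_in_Obj [simp]: "term_obj X \<in> Obj X"
  using term_obj_terminal by (simp add: restriction_terminal_def)

lemma bang_typing [simp]:
  assumes "A \<in> Obj X"
  shows "bang X A \<in> Arr X" "Dom X (bang X A) = A" "Cod X (bang X A) = term_obj X" "total X (bang X A)"
proof -
  have "\<exists>!t. t \<in> total_hom X A (term_obj X)"
    using term_obj_terminal assms by (simp add: restriction_terminal_def)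
  from theI'[OF this] have "bang X A \<in> total_hom X A (term_obj X)" unfolding bang_def .
  then show "bang X A \<in> Arr X" "Dom X (bang X A) = A" "Cod X (bang X A) = term_obj X"
    "total X (bang X A)" by (auto simp: total_hom_iff)
qed

lemma into_term_obj:
  assumes f: "f \<in> Arr X" "Cod X f = term_obj X"
  shows "f = \<rho> f \<cdot> bang X (Dom X f)"
proof -
  have "\<one> (term_obj X) \<in> total_hom X (term_obj X) (term_obj X)"
    "bang X (Dom X f) \<in> total_hom X (Dom X f) (term_obj X)"
    "f \<in> hom X (Dom X f) (term_obj X)"
    using f by (auto simp: total_hom_iff hom_iff)
  then have "f \<cdot> \<one> (term_obj X) \<preceq> bang X (Dom X f)"
    using term_obj_terminal unfolding restriction_terminal_def by blast
  then show ?thesis using f by (simp add: rle_def)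
qed

lemma into_term_obj_eq:
  assumes "f \<in> Arr X" "g \<in> Arr X" "Dom X f = Dom X g" "Cod X f = term_obj X" "Cod X g = term_obj X"
    and "\<rho> f = \<rho> g"
  shows "f = g"
  using into_term_obj[of f] into_term_obj[of g] assms by simp

end

section \<open>Group objects\<close>

context group_object
begin

lemma group_typing [simp]:
  "G \<in> Obj X"
  "m \<in> Arr X" "Dom X m = G \<otimes> G" "Cod X m = G" "total X m"
  "u \<in> Arr X" "Dom X u = term_obj X" "Cod X u = G" "total X u"
  "\<iota> \<in> Arr X" "Dom X \<iota> = G" "Cod X \<iota> = G" "total X \<iota>"
  using mult_hom unit_hom inv_hom by (auto simp: total_hom_iff G_Obj)

text \<open>Equal domains of definition keep the projections of the pairs free of restrictions.\<close>

lemma mult_assoc_elements: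
  assumes f: "f \<in> Arr X" "Cod X f = G" "g \<in> Arr X" "Cod X g = G" "h \<in> Arr X" "Cod X h = G"
    "Dom X f = Dom X g" "Dom X h = Dom X g" and r: "\<rho> f = \<rho> g" "\<rho> h = \<rho> g"
  shows "\<langle>\<langle>f, g\<rangle> \<cdot> m, h\<rangle> \<cdot> m = \<langle>f, \<langle>g, h\<rangle> \<cdot> m\<rangle> \<cdot> m"
proof -
  have e: "\<rho> g \<cdot> f = f" "\<rho> g \<cdot> h = h" using rst_self[of f] rst_self[of h] f r by auto
  have "\<langle>\<langle>f, g\<rangle>, h\<rangle> \<cdot> (\<langle>\<pi>\<^sub>0 (G \<otimes> G) G \<cdot> m, \<pi>\<^sub>1 (G \<otimes> G) G\<rangle> \<cdot> m) =
    \<langle>\<langle>f, g\<rangle>, h\<rangle> \<cdot> (\<langle>\<pi>\<^sub>0 (G \<otimes> G) G \<cdot> \<pi>\<^sub>0 G G, \<langle>\<pi>\<^sub>0 (G \<otimes> G) G \<cdot> \<pi>\<^sub>1 G G, \<pi>\<^sub>1 (G \<otimes> G) G\<rangle> \<cdot> m\<rangle> \<cdot> m)"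
    using mult_assoc by simp
  then show ?thesis using f r e by simp
qed

lemma unit_mult_elements:
  assumes "f \<in> Arr X" "Cod X f = G"
  shows "\<langle>f \<cdot> (bang X G \<cdot> u), f\<rangle> \<cdot> m = f"
  using arg_cong[OF unit_mult, of "\<lambda>k. f \<cdot> k"] assms by simp

lemma mult_unit_elements:
  assumes "f \<in> Arr X" "Cod X f = G"
  shows "\<langle>f, f \<cdot> (bang X G \<cdot> u)\<rangle> \<cdot> m = f"
  using arg_cong[OF mult_unit, of "\<lambda>k. f \<cdot> k"] assms by simp

lemma bang_const_eq:
  assumes "f \<in> Arr X" "g \<in> Arr X" "Dom X f = Dom X g" "\<rho> f = \<rho> g" "k \<in> Arr X" "Dom X k = term_obj X"
  shows "f \<cdot> (bang X (Cod X f) \<cdot> k) = g \<cdot> (bang X (Cod X g) \<cdot> k)"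
proof -
  have "f \<cdot> bang X (Cod X f) = g \<cdot> bang X (Cod X g)"
    by (rule into_term_obj_eq) (use assms in simp_all)
  from arg_cong[OF this, of "\<lambda>t. t \<cdot> k"] show ?thesis using assms by simp
qed

lemma cancel_inv_left:
  assumes f: "f \<in> Arr X" "Cod X f = G" "g \<in> Arr X" "Cod X g = G" "Dom X f = Dom X g" "\<rho> f = \<rho> g"
  shows "\<langle>f \<cdot> \<iota>, \<langle>f, g\<rangle> \<cdot> m\<rangle> \<cdot> m = g"
proof -
  have "\<langle>f \<cdot> \<iota>, \<langle>f, g\<rangle> \<cdot> m\<rangle> \<cdot> m = \<langle>\<langle>f \<cdot> \<iota>, f\<rangle> \<cdot> m, g\<rangle> \<cdot> m"
    using f by (intro mult_assoc_elements[symmetric]) simp_all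
  also have "\<langle>f \<cdot> \<iota>, f\<rangle> \<cdot> m = g \<cdot> (bang X G \<cdot> u)"
    using f arg_cong[OF inv_mult, of "\<lambda>k. f \<cdot> k"] bang_const_eq[of f g u] by simp
  finally show ?thesis using f unit_mult_elements[of g] by simp
qed

lemma cancel_left_inv:
  assumes f: "f \<in> Arr X" "Cod X f = G" "g \<in> Arr X" "Cod X g = G" "Dom X f = Dom X g" "\<rho> f = \<rho> g"
  shows "\<langle>f, \<langle>f \<cdot> \<iota>, g\<rangle> \<cdot> m\<rangle> \<cdot> m = g"
proof -
  have "\<langle>f, \<langle>f \<cdot> \<iota>, g\<rangle> \<cdot> m\<rangle> \<cdot> m = \<langle>\<langle>f, f \<cdot> \<iota>\<rangle> \<cdot> m, g\<rangle> \<cdot> m"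
    using f by (intro mult_assoc_elements[symmetric]) simp_all
  also have "\<langle>f, f \<cdot> \<iota>\<rangle> \<cdot> m = g \<cdot> (bang X G \<cdot> u)"
    using f arg_cong[OF mult_inv, of "\<lambda>k. f \<cdot> k"] bang_const_eq[of f g u] by simp
  finally show ?thesis using f unit_mult_elements[of g] by simp
qed

text \<open>The group laws enter the differential argument only through the invertibility of
  \<open>(g, h) \<mapsto> (g, gh)\<close>. An equation between composites is preserved by every functor, whereas the
  laws stated with pairings would have to be transported along \<open>\<T> (G \<otimes> G) \<cong> \<T> G \<otimes> \<T> G\<close>.\<close>

definition shear :: 'a where "shear = \<langle>\<pi>\<^sub>0 G G, m\<rangle>"
definition unshear :: 'a where "unshear = \<langle>\<pi>\<^sub>0 G G, \<langle>\<pi>\<^sub>0 G G \<cdot> \<iota>, \<pi>\<^sub>1 G G\<rangle> \<cdot> m\<rangle>"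

lemma shear_typing [simp]:
  "shear \<in> Arr X" "Dom X shear = G \<otimes> G" "Cod X shear = G \<otimes> G"
  "unshear \<in> Arr X" "Dom X unshear = G \<otimes> G" "Cod X unshear = G \<otimes> G" "total X unshear"
  by (simp_all add: shear_def unshear_def total_def[of X "\<langle>_, _\<rangle>"] totalD)

lemma shear_prj: "shear \<cdot> \<pi>\<^sub>0 G G = \<pi>\<^sub>0 G G" "shear \<cdot> \<pi>\<^sub>1 G G = m"
  "unshear \<cdot> \<pi>\<^sub>0 G G = \<pi>\<^sub>0 G G"
  by (simp_all add: shear_def unshear_def totalD)

lemma shear_unshear: "shear \<cdot> unshear = \<one> (G \<otimes> G)"
  using cancel_inv_left[of "\<pi>\<^sub>0 G G" "\<pi>\<^sub>1 G G"]
  by (simp add: shear_def unshear_def totalD)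

lemma unshear_mult: "unshear \<cdot> m = \<pi>\<^sub>1 G G"
  using cancel_left_inv[of "\<pi>\<^sub>0 G G" "\<pi>\<^sub>1 G G"]
  by (simp add: unshear_def totalD)

end

section \<open>The action of the structure group on a principal bundle\<close>

context principal_bundle
begin

abbreviation chart_inv :: "'i \<Rightarrow> 'a" ("\<beta>")
  where "\<beta> i \<equiv> partial_inverse X (\<alpha> i)"

lemma base_typing [simp]: "M \<in> Obj X"
  "q \<in> Arr X" "Dom X q = P" "Cod X q = M" "total X q"
  using base_Obj q_hom by (auto simp: total_hom_iff)

lemma bundle_Obj [simp]: "P \<in> Obj X"
  using Dom_in_Obj[of q] by simp

lemma chart_typing [simp]:
  assumes "i \<in> I"
  shows "\<alpha> i \<in> Arr X" "Dom X (\<alpha> i) = P" "Cod X (\<alpha> i) = M \<otimes> G"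
    "\<beta> i \<in> Arr X" "Dom X (\<beta> i) = M \<otimes> G" "Cod X (\<beta> i) = P"
    "\<alpha> i \<cdot> \<beta> i = \<rho> (\<alpha> i)" "\<beta> i \<cdot> \<alpha> i = \<rho> (\<beta> i)"
  using chart_hom[OF assms] is_partial_inverseD[OF partial_inverse[OF chart_partial_iso[OF assms]]]
  by (auto simp: hom_iff)

lemma transition_typing [simp]:
  assumes "i \<in> I" "j \<in> I"
  shows "\<tau> i j \<in> Arr X" "Dom X (\<tau> i j) = M" "Cod X (\<tau> i j) = G"
  using atlas_hom[OF assms] by (auto simp: hom_iff)

text \<open>Precomposition preserves joins, so the charts cover the domain of every element of \<open>P\<close>.
  All gluing below is done along such covers.\<close>

lemma charts_cover_at:
  assumes x: "x \<in> Arr X" "Cod X x = P"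
  shows "is_join X (Dom X x) (Dom X x) ((\<lambda>i. \<rho> (x \<cdot> \<alpha> i)) ` I) (\<rho> x)"
proof -
  have "is_join X (Dom X x) P ((\<lambda>i. x \<cdot> \<rho> (\<alpha> i)) ` I) x"
    using cmp_join[OF charts_cover, of x "Dom X x"] x by (simp add: image_image hom_iff)
  from rst_join[OF this] show ?thesis
    using x by (simp add: image_image cong: image_cong)
qed

lemma chart_local_eq:
  assumes x: "x \<in> Arr X" "Cod X x = P"
    and f: "f \<in> Arr X" "g \<in> Arr X" "Dom X f = Dom X x" "Dom X g = Dom X x" "Cod X f = Cod X g"
    and r: "\<rho> f = \<rho> x" "\<rho> g = \<rho> x"
    and eq: "\<And>i. i \<in> I \<Longrightarrow> \<rho> (x \<cdot> \<alpha> i) \<cdot> f = \<rho> (x \<cdot> \<alpha> i) \<cdot> g"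
  shows "f = g"
proof (rule local_eq[OF charts_cover_at[OF x]])
  show "f \<in> hom X (Dom X x) (Cod X g)" "g \<in> hom X (Dom X x) (Cod X g)"
    using f by (auto simp: hom_iff)
qed (use x r eq in auto)

lemma chart_glue:
  assumes x: "x \<in> Arr X" "Cod X x = P" and B: "B \<in> Obj X"
    and f: "\<And>i. i \<in> I \<Longrightarrow> f i \<in> Arr X" "\<And>i. i \<in> I \<Longrightarrow> Dom X (f i) = Dom X x"
      "\<And>i. i \<in> I \<Longrightarrow> Cod X (f i) = B" "\<And>i. i \<in> I \<Longrightarrow> \<rho> (f i) = \<rho> (x \<cdot> \<alpha> i)"
    and compat: "\<And>i j. i \<in> I \<Longrightarrow> j \<in> I \<Longrightarrow> \<rho> (x \<cdot> \<alpha> i) \<cdot> f j = \<rho> (x \<cdot> \<alpha> j) \<cdot> f i"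
  obtains g where "g \<in> Arr X" "Dom X g = Dom X x" "Cod X g = B" "\<rho> g = \<rho> x"
    "\<And>i. i \<in> I \<Longrightarrow> \<rho> (x \<cdot> \<alpha> i) \<cdot> g = f i"
proof -
  have cov: "is_join X (Dom X x) (Dom X x) ((\<lambda>i. \<rho> (f i)) ` I) (\<rho> x)"
    using charts_cover_at[OF x] f(4) by (simp cong: image_cong)
  have "f i \<in> hom X (Dom X x) B" if "i \<in> I" for i using f that by (auto simp: hom_iff)
  moreover have "\<rho> (f i) \<cdot> f j = \<rho> (f j) \<cdot> f i" if "i \<in> I" "j \<in> I" for i j
    using f(4) compat that by simp
  ultimately obtain g where "g \<in> hom X (Dom X x) B" "\<rho> g = \<rho> x" "\<And>i. i \<in> I \<Longrightarrow> \<rho> (f i) \<cdot> g = f i"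
    using glue[OF cov _ B, of thesis] Dom_in_Obj[OF x(1)] by blast
  then show ?thesis using f(4) by (intro that[of g]) (auto simp: hom_iff)
qed

lemma chart_base:
  assumes x: "x \<in> Arr X" "Cod X x = P" and i: "i \<in> I" "\<rho> (x \<cdot> \<alpha> i) = \<rho> x"
  shows "x \<cdot> (\<alpha> i \<cdot> \<pi>\<^sub>0 M G) = x \<cdot> q"
  using x i chart_prj0[OF i(1)] cmp_extend[OF restrict_to_domain[of x "\<alpha> i"], of q] by simp

text \<open>On the overlap of two charts \<open>\<alpha> j\<close> factors as \<open>\<alpha> i\<close> followed by the transition map
  \<open>\<beta> i \<cdot> \<alpha> j\<close>. The second claim holds because the transition map is defined exactly where
  \<open>\<tau> j i\<close> is.\<close>

lemma change_of_chart:
  assumes x: "x \<in> Arr X" "Cod X x = P" and i: "i \<in> I" "\<rho> (x \<cdot> \<alpha> i) = \<rho> x"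
    and j: "j \<in> I" "\<rho> (x \<cdot> \<alpha> j) = \<rho> x"
  shows "x \<cdot> (\<alpha> j \<cdot> \<pi>\<^sub>1 M G) = \<langle>x \<cdot> (q \<cdot> \<tau> j i), x \<cdot> (\<alpha> i \<cdot> \<pi>\<^sub>1 M G)\<rangle> \<cdot> m"
    and "\<rho> (x \<cdot> (q \<cdot> \<tau> j i)) = \<rho> x"
proof -
  have b: "x \<cdot> (\<alpha> i \<cdot> (\<pi>\<^sub>0 M G \<cdot> \<tau> j i)) = x \<cdot> (q \<cdot> \<tau> j i)"
    using arg_cong[OF chart_base[OF x i], of "\<lambda>t. t \<cdot> \<tau> j i"] x i j by simp
  have "x \<cdot> \<alpha> j = x \<cdot> \<rho> (\<alpha> i) \<cdot> \<alpha> j"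
    using restrict_to_domain[of x "\<alpha> i"] x i by simp
  also have "\<dots> = x \<cdot> (\<alpha> i \<cdot> (\<beta> i \<cdot> \<alpha> j))"
    using x i j cmp_extend[OF chart_typing(7)[OF i(1)], of "\<alpha> j"] by simp
  also have "\<dots> = \<langle>x \<cdot> q, \<langle>x \<cdot> (q \<cdot> \<tau> j i), x \<cdot> (\<alpha> i \<cdot> \<pi>\<^sub>1 M G)\<rangle> \<cdot> m\<rangle>"
    using x i j b chart_base[OF x i] transition[OF i(1) j(1)] by simp
  finally have e: "x \<cdot> \<alpha> j = \<langle>x \<cdot> q, \<langle>x \<cdot> (q \<cdot> \<tau> j i), x \<cdot> (\<alpha> i \<cdot> \<pi>\<^sub>1 M G)\<rangle> \<cdot> m\<rangle>" .
  have ri: "\<rho> (x \<cdot> (\<alpha> i \<cdot> \<pi>\<^sub>1 M G)) = \<rho> x"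
    using rst_cmp_total[of "\<pi>\<^sub>1 M G" "x \<cdot> \<alpha> i"] x i by simp
  have "\<rho> x \<cdot> (\<rho> (x \<cdot> (q \<cdot> \<tau> j i)) \<cdot> \<rho> x) = \<rho> x"
    using arg_cong[OF e, of "\<lambda>t. \<rho> t"] x i j ri by simp
  then show r: "\<rho> (x \<cdot> (q \<cdot> \<tau> j i)) = \<rho> x" using x i j by simp
  show "x \<cdot> (\<alpha> j \<cdot> \<pi>\<^sub>1 M G) = \<langle>x \<cdot> (q \<cdot> \<tau> j i), x \<cdot> (\<alpha> i \<cdot> \<pi>\<^sub>1 M G)\<rangle> \<cdot> m"
    using arg_cong[OF e, of "\<lambda>t. t \<cdot> \<pi>\<^sub>1 M G"] x i j r ri by simp
qed

text \<open>Right multiplication of the point \<open>x\<close> by \<open>g\<close>, carried out in the \<open>i\<close>-th chart.\<close>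

definition local_act :: "'i \<Rightarrow> 'a \<Rightarrow> 'a \<Rightarrow> 'a" where
  "local_act i x g = \<langle>x \<cdot> q, \<langle>x \<cdot> (\<alpha> i \<cdot> \<pi>\<^sub>1 M G), g\<rangle> \<cdot> m\<rangle> \<cdot> \<beta> i"

text \<open>The image of a chart is \<open>e \<times> 1\<close>, a union of whole fibres of \<open>M \<otimes> G\<close>; changing the fibre
  coordinate therefore stays inside it, and \<open>local_act i x g\<close> is defined wherever \<open>x\<close> is.\<close>

lemma local_act:
  assumes x: "x \<in> Arr X" "Cod X x = P" and i: "i \<in> I" "\<rho> (x \<cdot> \<alpha> i) = \<rho> x"
    and g: "g \<in> Arr X" "Cod X g = G" "Dom X g = Dom X x" "\<rho> g = \<rho> x"
  shows "local_act i x g \<in> Arr X" "Dom X (local_act i x g) = Dom X x" "Cod X (local_act i x g) = P"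
    "\<rho> (local_act i x g) = \<rho> x"
    "local_act i x g \<cdot> \<alpha> i = \<langle>x \<cdot> q, \<langle>x \<cdot> (\<alpha> i \<cdot> \<pi>\<^sub>1 M G), g\<rangle> \<cdot> m\<rangle>"
    "local_act i x g \<cdot> q = x \<cdot> q"
proof -
  define b where "b = \<langle>x \<cdot> q, \<langle>x \<cdot> (\<alpha> i \<cdot> \<pi>\<^sub>1 M G), g\<rangle> \<cdot> m\<rangle>"
  have act: "local_act i x g = b \<cdot> \<beta> i" by (simp add: local_act_def b_def)
  have rp: "\<rho> (x \<cdot> (\<alpha> i \<cdot> \<pi>\<^sub>1 M G)) = \<rho> x"
    using rst_cmp_total[of "\<pi>\<^sub>1 M G" "x \<cdot> \<alpha> i"] x i by simp
  have b: "b \<in> Arr X" "Dom X b = Dom X x" "Cod X b = M \<otimes> G" "\<rho> b = \<rho> x"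
    using x i g rp by (simp_all add: b_def)
  have b0: "b \<cdot> \<pi>\<^sub>0 M G = x \<cdot> q"
    using x i g rp by (simp add: b_def)
  \<comment> \<open>The chart lands in its image, so the base point satisfies \<open>x \<cdot> q \<cdot> e = x \<cdot> q\<close>; the same
    holds for \<open>b\<close>, which has the same base point.\<close>
  obtain e where e: "e \<in> hom X M M" "\<rho> (\<beta> i) = prd_map X e (\<one> G)"
    using chart_image[OF i(1)] by blast
  have e': "e \<in> Arr X" "Dom X e = M" "Cod X e = M" using e(1) by (auto simp: hom_iff)
  have \<beta>e: "\<rho> (\<beta> i) = \<langle>\<pi>\<^sub>0 M G \<cdot> e, \<pi>\<^sub>1 M G\<rangle>"
    using e e' by (simp add: prd_map_def)
  have \<alpha>\<beta>: "\<alpha> i \<cdot> \<rho> (\<beta> i) = \<alpha> i" using cmp_rst_swap[of "\<alpha> i" "\<beta> i"] i by simp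
  have "x \<cdot> q = x \<cdot> (\<alpha> i \<cdot> \<rho> (\<beta> i)) \<cdot> \<pi>\<^sub>0 M G" using chart_base[OF x i] x i \<alpha>\<beta> by simp
  also have "\<dots> = x \<cdot> (\<alpha> i \<cdot> (\<pi>\<^sub>0 M G \<cdot> e))"
    unfolding \<beta>e using x i e' rp by simp
  also have "\<dots> = x \<cdot> (q \<cdot> e)"
    using arg_cong[OF chart_base[OF x i], of "\<lambda>t. t \<cdot> e"] x i e' by simp
  finally have qe: "x \<cdot> (q \<cdot> e) = x \<cdot> q" by simp
  have "b \<cdot> \<rho> (\<beta> i) = \<langle>x \<cdot> q, b \<cdot> \<pi>\<^sub>1 M G\<rangle>"
    unfolding \<beta>e using b e' cmp_extend[OF b0, of e] x qe by simp
  also have "\<dots> = b" using b b0 rpair_eta[of M G b] by simp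
  finally have bb: "b \<cdot> \<rho> (\<beta> i) = b" .
  show "local_act i x g \<in> Arr X" "Dom X (local_act i x g) = Dom X x" "Cod X (local_act i x g) = P"
    using b i by (simp_all add: act)
  show r: "\<rho> (local_act i x g) = \<rho> x"
    using rst_cmp_rst[of b "\<beta> i"] b i bb by (simp add: act)
  show \<alpha>: "local_act i x g \<cdot> \<alpha> i = \<langle>x \<cdot> q, \<langle>x \<cdot> (\<alpha> i \<cdot> \<pi>\<^sub>1 M G), g\<rangle> \<cdot> m\<rangle>"
    using b i bb by (simp add: act flip: b_def)
  show "local_act i x g \<cdot> q = x \<cdot> q"
  proof -
    have "local_act i x g \<cdot> q = b \<cdot> \<beta> i \<cdot> (\<alpha> i \<cdot> \<pi>\<^sub>0 M G)"
      using chart_base[of "b \<cdot> \<beta> i" i] r \<alpha> b i by (simp add: act flip: b_def)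
    also have "\<dots> = b \<cdot> \<pi>\<^sub>0 M G"
      using b i cmp_extend[OF \<alpha>[unfolded act, folded b_def], of "\<pi>\<^sub>0 M G"] by simp
    finally show ?thesis by (simp add: b0)
  qed
qed

lemma local_act_eqI:
  assumes "y \<in> Arr X" "Cod X y = P" "y' \<in> Arr X" "Cod X y' = P" "Dom X y = Dom X y'" and i: "i \<in> I"
    and "\<rho> (y \<cdot> \<alpha> i) = \<rho> y" "\<rho> (y' \<cdot> \<alpha> i) = \<rho> y'" and eq: "y \<cdot> \<alpha> i = y' \<cdot> \<alpha> i"
  shows "y = y'"
proof -
  have "z = z \<cdot> \<alpha> i \<cdot> \<beta> i" if "z \<in> Arr X" "Cod X z = P" "\<rho> (z \<cdot> \<alpha> i) = \<rho> z" for z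
    using restrict_to_domain[of z "\<alpha> i"] that i by simp
  then show ?thesis using assms by metis
qed

text \<open>Changing the chart multiplies the fibre coordinate on the left by \<open>\<tau> j i\<close>, which commutes with
  multiplication by \<open>g\<close> on the right, by associativity.\<close>

lemma local_act_independent:
  assumes x: "x \<in> Arr X" "Cod X x = P" and i: "i \<in> I" "\<rho> (x \<cdot> \<alpha> i) = \<rho> x"
    and j: "j \<in> I" "\<rho> (x \<cdot> \<alpha> j) = \<rho> x"
    and g: "g \<in> Arr X" "Cod X g = G" "Dom X g = Dom X x" "\<rho> g = \<rho> x"
  shows "local_act i x g = local_act j x g"
proof -
  note A = local_act[OF x i g] and B = local_act[OF x j g]
  let ?t = "x \<cdot> (q \<cdot> \<tau> j i)" and ?xi = "x \<cdot> (\<alpha> i \<cdot> \<pi>\<^sub>1 M G)" and ?xj = "x \<cdot> (\<alpha> j \<cdot> \<pi>\<^sub>1 M G)"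
  note change = change_of_chart[OF x i j]
  have ri: "\<rho> ?xi = \<rho> x" using rst_cmp_total[of "\<pi>\<^sub>1 M G" "x \<cdot> \<alpha> i"] x i by simp
  have xg: "\<rho> x \<cdot> g = g" using rst_self[of g] g by simp
  define b where "b = \<langle>x \<cdot> q, \<langle>?xi, g\<rangle> \<cdot> m\<rangle>"
  have b: "b \<in> Arr X" "Dom X b = Dom X x" "Cod X b = M \<otimes> G" "\<rho> b = \<rho> x"
    using x i g ri by (simp_all add: b_def)
  have b0: "b \<cdot> \<pi>\<^sub>0 M G = x \<cdot> q" and b1: "b \<cdot> \<pi>\<^sub>1 M G = \<langle>?xi, g\<rangle> \<cdot> m"
    using x i g ri xg by (simp_all add: b_def)
  have b0': "b \<cdot> (\<pi>\<^sub>0 M G \<cdot> \<tau> j i) = ?t"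
    using cmp_extend[OF b0, of "\<tau> j i"] b x i j by simp
  have "local_act i x g \<cdot> \<alpha> j = b \<cdot> (\<beta> i \<cdot> \<alpha> j)"
    using b i j by (simp add: local_act_def flip: b_def)
  also have "\<dots> = \<langle>b \<cdot> \<pi>\<^sub>0 M G, \<langle>b \<cdot> (\<pi>\<^sub>0 M G \<cdot> \<tau> j i), b \<cdot> \<pi>\<^sub>1 M G\<rangle> \<cdot> m\<rangle>"
    using transition[OF i(1) j(1)] b i j by simp
  also have "\<dots> = \<langle>x \<cdot> q, \<langle>?t, \<langle>?xi, g\<rangle> \<cdot> m\<rangle> \<cdot> m\<rangle>"
    unfolding b0 b1 b0' ..
  also have "\<langle>?t, \<langle>?xi, g\<rangle> \<cdot> m\<rangle> \<cdot> m = \<langle>\<langle>?t, ?xi\<rangle> \<cdot> m, g\<rangle> \<cdot> m"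
    using x i j g ri change(2) by (intro mult_assoc_elements[symmetric]) simp_all
  also have "\<langle>?t, ?xi\<rangle> \<cdot> m = ?xj" using change(1) by simp
  also have "\<langle>x \<cdot> q, \<langle>?xj, g\<rangle> \<cdot> m\<rangle> = local_act j x g \<cdot> \<alpha> j" using B by simp
  finally have eq: "local_act i x g \<cdot> \<alpha> j = local_act j x g \<cdot> \<alpha> j" .
  have rj: "\<rho> ?xj = \<rho> x" using rst_cmp_total[of "\<pi>\<^sub>1 M G" "x \<cdot> \<alpha> j"] x j by simp
  have "\<rho> (local_act j x g \<cdot> \<alpha> j) = \<rho> x" unfolding B(5) using x j g rj by simp
  then show ?thesis
    by (intro local_act_eqI[OF A(1,3) B(1,3) _ j(1) _ _ eq]) (simp_all add: A B(2,4) eq)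
qed

lemma cmp_local_act:
  assumes "x \<in> Arr X" "Cod X x = P" "i \<in> I" "g \<in> Arr X" "Cod X g = G" "Dom X g = Dom X x"
    and "h \<in> Arr X" "Cod X h = Dom X x"
  shows "h \<cdot> local_act i x g = local_act i (h \<cdot> x) (h \<cdot> g)"
  using assms by (simp add: local_act_def)

lemma local_act_unit:
  assumes i: "i \<in> I"
  shows "local_act i (\<rho> (\<alpha> i)) (\<rho> (\<alpha> i) \<cdot> (bang X P \<cdot> u)) = \<rho> (\<alpha> i)"
proof -
  let ?x = "\<rho> (\<alpha> i)" and ?g = "\<rho> (\<alpha> i) \<cdot> (bang X P \<cdot> u)"
  have x: "?x \<in> Arr X" "Cod X ?x = P" "\<rho> (?x \<cdot> \<alpha> i) = \<rho> ?x"
    and g: "?g \<in> Arr X" "Cod X ?g = G" "Dom X ?g = Dom X ?x" "\<rho> ?g = \<rho> ?x"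
    using i by simp_all
  note A = local_act[OF x(1,2) i x(3) g]
  have ap: "\<rho> (\<alpha> i \<cdot> \<pi>\<^sub>1 M G) = \<rho> (\<alpha> i)" using i by simp
  have "?g = \<alpha> i \<cdot> \<pi>\<^sub>1 M G \<cdot> (bang X G \<cdot> u)"
    using bang_const_eq[of "\<alpha> i \<cdot> \<pi>\<^sub>1 M G" ?x u] i by simp
  then have "\<langle>\<alpha> i \<cdot> \<pi>\<^sub>1 M G, ?g\<rangle> \<cdot> m = \<alpha> i \<cdot> \<pi>\<^sub>1 M G"
    using i mult_unit_elements[of "\<alpha> i \<cdot> \<pi>\<^sub>1 M G"] by simp
  then have "local_act i ?x ?g \<cdot> \<alpha> i = \<langle>\<alpha> i \<cdot> \<pi>\<^sub>0 M G, \<alpha> i \<cdot> \<pi>\<^sub>1 M G\<rangle>"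
    using A(5) i chart_prj0[OF i] by simp
  also have "\<dots> = \<alpha> i"
    using i by (intro rpair_eta) simp_all
  finally have eq: "local_act i ?x ?g \<cdot> \<alpha> i = ?x \<cdot> \<alpha> i" using i by simp
  have r: "\<rho> (local_act i ?x ?g \<cdot> \<alpha> i) = \<rho> (local_act i ?x ?g)"
    unfolding eq using A(4) i by simp
  show ?thesis
    by (rule local_act_eqI[OF A(1,3) x(1,2) _ i r x(3) eq]) (use A(2) in simp)
qed

text \<open>The element \<open>(x, g)\<close> of \<open>P \<otimes> G\<close> seen in the \<open>i\<close>-th chart: the fibre coordinate of \<open>x\<close>
  together with \<open>g\<close>. Its composites with \<open>m\<close> and with the shear describe the action.\<close>

definition fibre_pair :: "'i \<Rightarrow> 'a" ("\<gamma>")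
  where "\<gamma> i = \<langle>\<pi>\<^sub>0 P G \<cdot> (\<alpha> i \<cdot> \<pi>\<^sub>1 M G), \<pi>\<^sub>1 P G\<rangle>"

lemma fibre_pair:
  assumes "i \<in> I"
  shows "\<gamma> i \<in> Arr X" "Dom X (\<gamma> i) = P \<otimes> G" "Cod X (\<gamma> i) = G \<otimes> G"
    "\<gamma> i \<cdot> \<pi>\<^sub>0 G G = \<pi>\<^sub>0 P G \<cdot> (\<alpha> i \<cdot> \<pi>\<^sub>1 M G)"
    "\<gamma> i \<cdot> \<pi>\<^sub>1 G G = \<rho> (\<pi>\<^sub>0 P G \<cdot> \<alpha> i) \<cdot> \<pi>\<^sub>1 P G"
    "\<rho> (\<gamma> i) = \<rho> (\<pi>\<^sub>0 P G \<cdot> \<alpha> i)"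
proof -
  have r: "\<rho> (\<pi>\<^sub>0 P G \<cdot> (\<alpha> i \<cdot> \<pi>\<^sub>1 M G)) = \<rho> (\<pi>\<^sub>0 P G \<cdot> \<alpha> i)"
    using rst_cmp_total[of "\<pi>\<^sub>1 M G" "\<pi>\<^sub>0 P G \<cdot> \<alpha> i"] assms by simp
  then show "\<gamma> i \<in> Arr X" "Dom X (\<gamma> i) = P \<otimes> G" "Cod X (\<gamma> i) = G \<otimes> G"
    "\<gamma> i \<cdot> \<pi>\<^sub>0 G G = \<pi>\<^sub>0 P G \<cdot> (\<alpha> i \<cdot> \<pi>\<^sub>1 M G)"
    "\<gamma> i \<cdot> \<pi>\<^sub>1 G G = \<rho> (\<pi>\<^sub>0 P G \<cdot> \<alpha> i) \<cdot> \<pi>\<^sub>1 P G"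
    "\<rho> (\<gamma> i) = \<rho> (\<pi>\<^sub>0 P G \<cdot> \<alpha> i)"
    using assms by (simp_all add: fibre_pair_def totalD)
qed

text \<open>The last conjunct is restricted to points \<open>(x, g)\<close> with \<open>x\<close> in the domain of the chart, where
  it says that the action is right multiplication of fibre coordinates.\<close>

definition is_action :: "'a \<Rightarrow> bool" where
  "is_action a \<longleftrightarrow> a \<in> total_hom X (P \<otimes> G) P \<and> a \<cdot> q = \<pi>\<^sub>0 P G \<cdot> q \<and>
     \<langle>\<one> P, bang X P \<cdot> u\<rangle> \<cdot> a = \<one> P \<and>
     (\<forall>i\<in>I. \<rho> (\<pi>\<^sub>0 P G \<cdot> \<alpha> i) \<cdot> (a \<cdot> (\<alpha> i \<cdot> \<pi>\<^sub>1 M G)) = \<gamma> i \<cdot> m)"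

text \<open>On the domain of the \<open>i\<close>-th chart the action is \<open>local_act i\<close> applied to the two projections;
  independence of the chart lets these maps be glued.\<close>

lemma action_exists: "\<exists>a. is_action a"
proof -
  let ?E = "\<lambda>i. \<rho> (\<pi>\<^sub>0 P G \<cdot> \<alpha> i)"
  let ?x = "\<lambda>i. ?E i \<cdot> \<pi>\<^sub>0 P G" and ?g = "\<lambda>i. ?E i \<cdot> \<pi>\<^sub>1 P G"
  let ?f = "\<lambda>i. local_act i (?x i) (?g i)"
  have x: "?x i \<in> Arr X" "Cod X (?x i) = P" "Dom X (?x i) = P \<otimes> G" "\<rho> (?x i) = ?E i" 
      "\<rho> (?x i \<cdot> \<alpha> i) = \<rho> (?x i)"
    and g: "?g i \<in> Arr X" "Cod X (?g i) = G" "Dom X (?g i) = Dom X (?x i)" "\<rho> (?g i) = \<rho> (?x i)"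
    if "i \<in> I" for i
    using that by simp_all
  have f: "?f i \<in> Arr X" "Dom X (?f i) = P \<otimes> G" "Cod X (?f i) = P" "\<rho> (?f i) = ?E i"
    "?f i \<cdot> \<alpha> i = \<langle>?x i \<cdot> q, \<langle>?x i \<cdot> (\<alpha> i \<cdot> \<pi>\<^sub>1 M G), ?g i\<rangle> \<cdot> m\<rangle>"
    "?f i \<cdot> q = ?x i \<cdot> q" if "i \<in> I" for i
    using local_act[OF x(1,2)[OF that] that x(5)[OF that] g[OF that]] x(3,4)[OF that] by simp_all
  have compat: "?E i \<cdot> ?f j = ?E j \<cdot> ?f i" if i: "i \<in> I" and j: "j \<in> I" for i j
  proof -
    have c: "?E j \<cdot> ?E i = ?E i \<cdot> ?E j" using i j by (intro rst_comm) simp_all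
    have c': "?E j \<cdot> (?E i \<cdot> t) = ?E i \<cdot> (?E j \<cdot> t)" if "t \<in> Arr X" "Dom X t = P \<otimes> G" for t
      using cmp_extend[OF c, of t] i j that by simp
    let ?y = "?E i \<cdot> ?x j" and ?h = "?E i \<cdot> ?g j"
    have "?E i \<cdot> ?f j = local_act j ?y ?h" using i j by (intro cmp_local_act) simp_all
    also have "\<dots> = local_act i ?y ?h"
      using i j c c' by (intro local_act_independent) simp_all
    also have "\<dots> = local_act i (?E j \<cdot> ?x i) (?E j \<cdot> ?g i)"
      using i j c' by simp
    also have "\<dots> = ?E j \<cdot> ?f i" using i j by (intro cmp_local_act[symmetric]) simp_all
    finally show ?thesis .
  qed
  obtain a where a: "a \<in> Arr X" "Dom X a = P \<otimes> G" "Cod X a = P" "\<rho> a = \<rho> (\<pi>\<^sub>0 P G)"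
    and loc: "\<And>i. i \<in> I \<Longrightarrow> ?E i \<cdot> a = ?f i"
    using chart_glue[of "\<pi>\<^sub>0 P G" P ?f] f x compat by simp metis
  have tot: "total X a" using a by (simp add: total_def[of X a] totalD)
  have loc': "?E i \<cdot> (a \<cdot> t) = ?f i \<cdot> t" if "i \<in> I" "t \<in> Arr X" "Dom X t = P" for i t
    using cmp_extend[OF loc[OF that(1)], of t] a that by simp
  have "a \<cdot> q = \<pi>\<^sub>0 P G \<cdot> q"
  proof (rule chart_local_eq[of "\<pi>\<^sub>0 P G"])
    fix i assume i: "i \<in> I"
    have "?E i \<cdot> (a \<cdot> q) = ?x i \<cdot> q" using loc'[OF i, of q] f(6)[OF i] i by simp
    then show "?E i \<cdot> (a \<cdot> q) = ?E i \<cdot> (\<pi>\<^sub>0 P G \<cdot> q)" using i by simp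
  qed (use a tot in simp_all)
  moreover
  define h where "h = \<langle>\<one> P, bang X P \<cdot> u\<rangle>"
  have h: "h \<in> Arr X" "Dom X h = P" "Cod X h = P \<otimes> G" "h \<cdot> \<pi>\<^sub>0 P G = \<one> P"
    "h \<cdot> \<pi>\<^sub>1 P G = bang X P \<cdot> u" "\<rho> h = \<one> P" by (simp_all add: h_def totalD)
  have "h \<cdot> a = \<one> P"
  proof (rule chart_local_eq[of "\<one> P"])
    fix i assume i: "i \<in> I"
    have "h \<cdot> (\<pi>\<^sub>0 P G \<cdot> \<alpha> i) = \<alpha> i" using cmp_extend[OF h(4), of "\<alpha> i"] h i by simp
    then have hE: "h \<cdot> ?E i = \<rho> (\<alpha> i) \<cdot> h"
      using cmp_rst_swap[of h "\<pi>\<^sub>0 P G \<cdot> \<alpha> i"] h i by simp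
    have hE': "h \<cdot> (?E i \<cdot> t) = \<rho> (\<alpha> i) \<cdot> (h \<cdot> t)" if "t \<in> Arr X" "Dom X t = P \<otimes> G" for t
      using cmp_extend[OF hE, of t] h i that by simp
    have "\<rho> (\<alpha> i) \<cdot> (h \<cdot> a) = h \<cdot> (?E i \<cdot> a)" using hE' a by simp
    also have "\<dots> = local_act i (h \<cdot> ?x i) (h \<cdot> ?g i)"
      unfolding loc[OF i] using i h by (intro cmp_local_act) simp_all
    also have "\<dots> = \<rho> (\<alpha> i)"
      using local_act_unit[OF i] hE' h i by simp
    finally show "\<rho> (\<one> P \<cdot> \<alpha> i) \<cdot> (h \<cdot> a) = \<rho> (\<one> P \<cdot> \<alpha> i) \<cdot> \<one> P" using i by simp
  qed (use a h tot in simp_all)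
  moreover have "?E i \<cdot> (a \<cdot> (\<alpha> i \<cdot> \<pi>\<^sub>1 M G)) = \<gamma> i \<cdot> m" if i: "i \<in> I" for i
  proof -
    have r: "\<rho> (\<pi>\<^sub>0 P G \<cdot> (\<alpha> i \<cdot> \<pi>\<^sub>1 M G)) = ?E i"
      using rst_cmp_total[of "\<pi>\<^sub>1 M G" "\<pi>\<^sub>0 P G \<cdot> \<alpha> i"] i by simp
    have "?E i \<cdot> (a \<cdot> (\<alpha> i \<cdot> \<pi>\<^sub>1 M G)) = ?f i \<cdot> \<alpha> i \<cdot> \<pi>\<^sub>1 M G"
      using loc'[OF i, of "\<alpha> i \<cdot> \<pi>\<^sub>1 M G"] f(1-3)[OF i] i by simp
    also have "\<dots> = \<langle>?x i \<cdot> (\<alpha> i \<cdot> \<pi>\<^sub>1 M G), ?g i\<rangle> \<cdot> m"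
      unfolding f(5)[OF i] using i r by simp
    also have "\<dots> = ?E i \<cdot> \<gamma> i \<cdot> m"
      using i by (simp add: fibre_pair_def)
    also have "?E i \<cdot> \<gamma> i = \<gamma> i" using fibre_pair[OF i] rst_self[of "\<gamma> i"] by simp
    finally show ?thesis .
  qed
  ultimately have "is_action a" using a tot by (simp add: is_action_def total_hom_iff h_def)
  then show ?thesis ..
qed

definition action :: 'a ("\<a>") where "\<a> = (SOME a. is_action a)"

lemma action_typing [simp]:
  "\<a> \<in> Arr X" "Dom X \<a> = P \<otimes> G" "Cod X \<a> = P" "total X \<a>"
  using someI_ex[OF action_exists] by (auto simp: action_def is_action_def total_hom_iff)

lemma action_base: "\<a> \<cdot> q = \<pi>\<^sub>0 P G \<cdot> q"
  and action_unit: "\<langle>\<one> P, bang X P \<cdot> u\<rangle> \<cdot> \<a> = \<one> P"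
  and action_fibre:
    "i \<in> I \<Longrightarrow> \<rho> (\<pi>\<^sub>0 P G \<cdot> \<alpha> i) \<cdot> (\<a> \<cdot> (\<alpha> i \<cdot> \<pi>\<^sub>1 M G)) = \<gamma> i \<cdot> m"
  using someI_ex[OF action_exists] by (auto simp: action_def is_action_def)

end

section \<open>The tangent functor\<close>

context cartesian_tangent_join_restriction_category
begin

lemma tangent_typing [simp]:
  assumes "A \<in> Obj X"
  shows "\<T> A \<in> Obj X"
    "\<p> A \<in> Arr X" "Dom X (\<p> A) = \<T> A" "Cod X (\<p> A) = A" "total X (\<p> A)"
    "\<zero> A \<in> Arr X" "Dom X (\<zero> A) = A" "Cod X (\<zero> A) = \<T> A" "total X (\<zero> A)"
  using tobj_Obj tproj_hom[OF assms] tzero_hom[OF assms] assms by (auto simp: total_hom_iff)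

lemma tmap_typing [simp]:
  assumes "f \<in> Arr X"
  shows "\<T>\<^sub>m f \<in> Arr X" "Dom X (\<T>\<^sub>m f) = \<T> (Dom X f)" "Cod X (\<T>\<^sub>m f) = \<T> (Cod X f)"
  using tmap_hom[of f "Dom X f" "Cod X f"] assms by (auto simp: hom_iff)

lemma tmap_functor [simp]:
  assumes "f \<in> Arr X" "g \<in> Arr X" "Cod X f = Dom X g"
  shows "\<T>\<^sub>m (f \<cdot> g) = \<T>\<^sub>m f \<cdot> \<T>\<^sub>m g"
  using tmap_cmp[of f "Dom X f" "Cod X f" g "Cod X g"] assms by (auto simp: hom_iff)

lemma tmap_restriction [simp]: "f \<in> Arr X \<Longrightarrow> \<T>\<^sub>m (\<rho> f) = \<rho> (\<T>\<^sub>m f)"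
  using tmap_rst[of f "Dom X f" "Cod X f"] by (auto simp: hom_iff)

lemma tmap_one [simp]: "A \<in> Obj X \<Longrightarrow> \<T>\<^sub>m (\<one> A) = \<one> (\<T> A)"
  by (rule tmap_ident)

lemma tmap_total [simp]: "total X f \<Longrightarrow> f \<in> Arr X \<Longrightarrow> total X (\<T>\<^sub>m f)"
  using tmap_restriction[of f] by (simp add: total_def)

lemma proj_natural:
  "f \<in> Arr X \<Longrightarrow> Dom X f = A \<Longrightarrow> Cod X f = B \<Longrightarrow> \<T>\<^sub>m f \<cdot> \<p> B = \<p> A \<cdot> f"
  by (rule tproj_natural) (simp add: hom_iff)

lemma zero_natural:
  "f \<in> Arr X \<Longrightarrow> Dom X f = A \<Longrightarrow> Cod X f = B \<Longrightarrow> \<zero> A \<cdot> \<T>\<^sub>m f = f \<cdot> \<zero> B"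
  by (rule tzero_natural[symmetric]) (simp add: hom_iff)

lemma zero_proj [simp]: "A \<in> Obj X \<Longrightarrow> \<zero> A \<cdot> \<p> A = \<one> A"
  using tangent_additive[of A] by (simp add: additive_bundle_def tangent_bundle_def Let_def)

text \<open>Since \<open>\<T>\<^sub>m f\<close> lies over \<open>f\<close>, a tangent vector is in the domain of \<open>\<T>\<^sub>m f\<close> as soon as
  its base point is in the domain of \<open>f\<close>.\<close>

lemma rst_cmp_tmap:
  assumes "y \<in> Arr X" "f \<in> Arr X" "Cod X y = \<T> (Dom X f)"
  shows "\<rho> (y \<cdot> \<T>\<^sub>m f) = \<rho> (y \<cdot> (\<p> (Dom X f) \<cdot> f))"
proof -
  have "\<rho> (y \<cdot> \<T>\<^sub>m f) = \<rho> (y \<cdot> \<T>\<^sub>m f \<cdot> \<p> (Cod X f))"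
    using rst_cmp_total[of "\<p> (Cod X f)" "y \<cdot> \<T>\<^sub>m f"] assms by simp
  then show ?thesis using proj_natural[OF assms(2) refl refl] assms by simp
qed

lemma tprd_ext:
  assumes "A \<in> Obj X" "B \<in> Obj X"
    and "h \<in> Arr X" "k \<in> Arr X" "Dom X h = Dom X k" "Cod X h = \<T> (A \<otimes> B)" "Cod X k = \<T> (A \<otimes> B)"
    and "h \<cdot> \<T>\<^sub>m (\<pi>\<^sub>0 A B) = k \<cdot> \<T>\<^sub>m (\<pi>\<^sub>0 A B)" "h \<cdot> \<T>\<^sub>m (\<pi>\<^sub>1 A B) = k \<cdot> \<T>\<^sub>m (\<pi>\<^sub>1 A B)"
  shows "h = k"
  using restriction_product_ext[OF tobj_prd[OF assms(1,2)]] assms(3-) by blast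

lemma tprd_pair:
  assumes "f \<in> Arr X" "g \<in> Arr X" "Dom X f = Dom X g" "Cod X f = \<T> A" "Cod X g = \<T> B" "\<rho> f = \<rho> g"
    and "A \<in> Obj X" "B \<in> Obj X"
  obtains h where "h \<in> Arr X" "Dom X h = Dom X f" "Cod X h = \<T> (A \<otimes> B)"
    "h \<cdot> \<T>\<^sub>m (\<pi>\<^sub>0 A B) = f" "h \<cdot> \<T>\<^sub>m (\<pi>\<^sub>1 A B) = g" "\<rho> h = \<rho> f"
  using restriction_product_pair[OF tobj_prd[OF assms(7,8)] assms(1-6)] that by blast

end

section \<open>Tangent vectors of a principal bundle\<close>

locale tangent_principal_bundle =
  cartesian_tangent_join_restriction_category X + principal_bundle X G m u \<iota> M P q I \<alpha> \<tau>
  for X :: "('o, 'a, 'z) tangent_rcat_scheme" (structure) and G m u \<iota> M P q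
    and I :: "'i set" and \<alpha> \<tau>
begin

text \<open>These are the equations \<open>fibre_pair\<close> and \<open>action_fibre\<close> after applying \<open>\<T>\<close>, with the
  restriction of the chart moved to the front of an element \<open>h\<close> of \<open>\<T> (P \<otimes> G)\<close>.\<close>

lemma tangent_fibre_pair:
  assumes h: "h \<in> Arr X" "Cod X h = \<T> (P \<otimes> G)" and i: "i \<in> I"
  shows "h \<cdot> (\<T>\<^sub>m (\<gamma> i) \<cdot> \<T>\<^sub>m (\<pi>\<^sub>0 G G)) = h \<cdot> (\<T>\<^sub>m (\<pi>\<^sub>0 P G) \<cdot> (\<T>\<^sub>m (\<alpha> i) \<cdot> \<T>\<^sub>m (\<pi>\<^sub>1 M G)))"
    and "h \<cdot> (\<T>\<^sub>m (\<gamma> i) \<cdot> \<T>\<^sub>m (\<pi>\<^sub>1 G G)) =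
      \<rho> (h \<cdot> (\<T>\<^sub>m (\<pi>\<^sub>0 P G) \<cdot> \<T>\<^sub>m (\<alpha> i))) \<cdot> (h \<cdot> \<T>\<^sub>m (\<pi>\<^sub>1 P G))"
    and "h \<cdot> (\<T>\<^sub>m (\<gamma> i) \<cdot> \<T>\<^sub>m m) = \<rho> (h \<cdot> (\<T>\<^sub>m (\<pi>\<^sub>0 P G) \<cdot> \<T>\<^sub>m (\<alpha> i))) \<cdot>
      (h \<cdot> (\<T>\<^sub>m \<a> \<cdot> (\<T>\<^sub>m (\<alpha> i) \<cdot> \<T>\<^sub>m (\<pi>\<^sub>1 M G))))"
proof -
  note \<gamma> = fibre_pair[OF i]
  let ?d = "\<T>\<^sub>m (\<pi>\<^sub>0 P G) \<cdot> \<T>\<^sub>m (\<alpha> i)"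
  have swap: "h \<cdot> (\<rho> ?d \<cdot> t) = \<rho> (h \<cdot> ?d) \<cdot> (h \<cdot> t)" if "t \<in> Arr X" "Dom X t = \<T> (P \<otimes> G)" for t
    using cmp_extend[OF cmp_rst_swap[of h ?d], of t] h i that by simp
  show "h \<cdot> (\<T>\<^sub>m (\<gamma> i) \<cdot> \<T>\<^sub>m (\<pi>\<^sub>0 G G)) = h \<cdot> (\<T>\<^sub>m (\<pi>\<^sub>0 P G) \<cdot> (\<T>\<^sub>m (\<alpha> i) \<cdot> \<T>\<^sub>m (\<pi>\<^sub>1 M G)))"
    using arg_cong[OF \<gamma>(4), of "\<T>\<^sub>m"] \<gamma>(1-3) i by simp
  have "\<T>\<^sub>m (\<gamma> i) \<cdot> \<T>\<^sub>m (\<pi>\<^sub>1 G G) = \<rho> ?d \<cdot> \<T>\<^sub>m (\<pi>\<^sub>1 P G)"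
    using arg_cong[OF \<gamma>(5), of "\<T>\<^sub>m"] \<gamma>(1-3) i by simp
  then show "h \<cdot> (\<T>\<^sub>m (\<gamma> i) \<cdot> \<T>\<^sub>m (\<pi>\<^sub>1 G G)) = \<rho> (h \<cdot> ?d) \<cdot> (h \<cdot> \<T>\<^sub>m (\<pi>\<^sub>1 P G))"
    using swap[of "\<T>\<^sub>m (\<pi>\<^sub>1 P G)"] by simp
  have "\<T>\<^sub>m (\<gamma> i) \<cdot> \<T>\<^sub>m m = \<rho> ?d \<cdot> (\<T>\<^sub>m \<a> \<cdot> (\<T>\<^sub>m (\<alpha> i) \<cdot> \<T>\<^sub>m (\<pi>\<^sub>1 M G)))"
    using arg_cong[OF action_fibre[OF i], of "\<T>\<^sub>m"] \<gamma>(1-3) i by simp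
  then show "h \<cdot> (\<T>\<^sub>m (\<gamma> i) \<cdot> \<T>\<^sub>m m) = \<rho> (h \<cdot> ?d) \<cdot>
      (h \<cdot> (\<T>\<^sub>m \<a> \<cdot> (\<T>\<^sub>m (\<alpha> i) \<cdot> \<T>\<^sub>m (\<pi>\<^sub>1 M G))))"
    using swap[of "\<T>\<^sub>m \<a> \<cdot> (\<T>\<^sub>m (\<alpha> i) \<cdot> \<T>\<^sub>m (\<pi>\<^sub>1 M G))"] i by simp
qed

text \<open>In each chart \<open>h\<close> is determined by the fibre coordinates of its point and of its translate,
  because the shear map is invertible; the charts containing the base point cover, so \<open>h\<close> is
  determined globally.\<close>

lemma tangent_action_free:
  assumes h: "h \<in> Arr X" "Cod X h = \<T> (P \<otimes> G)"
    and k: "k \<in> Arr X" "Cod X k = \<T> (P \<otimes> G)" "Dom X k = Dom X h"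
    and eq0: "h \<cdot> \<T>\<^sub>m (\<pi>\<^sub>0 P G) = k \<cdot> \<T>\<^sub>m (\<pi>\<^sub>0 P G)" and eqa: "h \<cdot> \<T>\<^sub>m \<a> = k \<cdot> \<T>\<^sub>m \<a>"
  shows "h = k"
proof (rule tprd_ext[of P G])
  let ?x = "h \<cdot> (\<T>\<^sub>m (\<pi>\<^sub>0 P G) \<cdot> \<p> P)"
  have x: "?x \<in> Arr X" "Cod X ?x = P" "Dom X ?x = Dom X h" "\<rho> ?x = \<rho> h"
    using h by simp_all
  have rk: "\<rho> k = \<rho> h"
    using rst_cmp_total[of "\<T>\<^sub>m \<a>" h] rst_cmp_total[of "\<T>\<^sub>m \<a>" k] h k eqa by simp
  show "h \<cdot> \<T>\<^sub>m (\<pi>\<^sub>1 P G) = k \<cdot> \<T>\<^sub>m (\<pi>\<^sub>1 P G)"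
  proof (rule chart_local_eq[OF x(1,2)])
    fix i assume i: "i \<in> I"
    note \<gamma> = fibre_pair[OF i]
    note H = tangent_fibre_pair[OF h i] and K = tangent_fibre_pair[OF k(1,2) i]
    have e0: "h \<cdot> (\<T>\<^sub>m (\<pi>\<^sub>0 P G) \<cdot> t) = k \<cdot> (\<T>\<^sub>m (\<pi>\<^sub>0 P G) \<cdot> t)" if "t \<in> Arr X" "Dom X t = \<T> P" for t
      using cmp_extend[OF eq0, of t] h k that by simp
    have ea: "h \<cdot> (\<T>\<^sub>m \<a> \<cdot> t) = k \<cdot> (\<T>\<^sub>m \<a> \<cdot> t)" if "t \<in> Arr X" "Dom X t = \<T> P" for t
      using cmp_extend[OF eqa, of t] h k that by simp
    have e: "\<rho> (h \<cdot> (\<T>\<^sub>m (\<pi>\<^sub>0 P G) \<cdot> \<T>\<^sub>m (\<alpha> i))) = \<rho> (?x \<cdot> \<alpha> i)"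
      using rst_cmp_tmap[of "h \<cdot> \<T>\<^sub>m (\<pi>\<^sub>0 P G)" "\<alpha> i"] h i by simp
    have sp: "\<T>\<^sub>m shear \<cdot> \<T>\<^sub>m (\<pi>\<^sub>0 G G) = \<T>\<^sub>m (\<pi>\<^sub>0 G G)" "\<T>\<^sub>m shear \<cdot> \<T>\<^sub>m (\<pi>\<^sub>1 G G) = \<T>\<^sub>m m"
      using tmap_functor[of shear "\<pi>\<^sub>0 G G"] tmap_functor[of shear "\<pi>\<^sub>1 G G"] by (simp_all add: shear_prj)
    have su: "\<T>\<^sub>m shear \<cdot> \<T>\<^sub>m unshear = \<one> (\<T> (G \<otimes> G))"
      using tmap_functor[of shear unshear] by (simp add: shear_unshear)
    have "h \<cdot> (\<T>\<^sub>m (\<gamma> i) \<cdot> \<T>\<^sub>m shear) = k \<cdot> (\<T>\<^sub>m (\<gamma> i) \<cdot> \<T>\<^sub>m shear)"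
    proof (rule tprd_ext[of G G])
      show "h \<cdot> (\<T>\<^sub>m (\<gamma> i) \<cdot> \<T>\<^sub>m shear) \<cdot> \<T>\<^sub>m (\<pi>\<^sub>0 G G) = k \<cdot> (\<T>\<^sub>m (\<gamma> i) \<cdot> \<T>\<^sub>m shear) \<cdot> \<T>\<^sub>m (\<pi>\<^sub>0 G G)"
        using h k \<gamma>(1-3) i H(1) K(1) e0 by (simp add: sp)
      show "h \<cdot> (\<T>\<^sub>m (\<gamma> i) \<cdot> \<T>\<^sub>m shear) \<cdot> \<T>\<^sub>m (\<pi>\<^sub>1 G G) = k \<cdot> (\<T>\<^sub>m (\<gamma> i) \<cdot> \<T>\<^sub>m shear) \<cdot> \<T>\<^sub>m (\<pi>\<^sub>1 G G)"
        using h k \<gamma>(1-3) i H(3) K(3) e0 ea by (simp add: sp)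
    qed (use h k \<gamma>(1-3) in simp_all)
    from arg_cong[OF this, of "\<lambda>t. t \<cdot> \<T>\<^sub>m unshear"]
    have "h \<cdot> \<T>\<^sub>m (\<gamma> i) = k \<cdot> \<T>\<^sub>m (\<gamma> i)"
      using h k \<gamma>(1-3) by (simp add: su)
    from arg_cong[OF this, of "\<lambda>t. t \<cdot> \<T>\<^sub>m (\<pi>\<^sub>1 G G)"]
    have "h \<cdot> (\<T>\<^sub>m (\<gamma> i) \<cdot> \<T>\<^sub>m (\<pi>\<^sub>1 G G)) = k \<cdot> (\<T>\<^sub>m (\<gamma> i) \<cdot> \<T>\<^sub>m (\<pi>\<^sub>1 G G))"
      using h k \<gamma>(1-3) by simp
    then show "\<rho> (?x \<cdot> \<alpha> i) \<cdot> (h \<cdot> \<T>\<^sub>m (\<pi>\<^sub>1 P G)) = \<rho> (?x \<cdot> \<alpha> i) \<cdot> (k \<cdot> \<T>\<^sub>m (\<pi>\<^sub>1 P G))"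
      unfolding H(2) K(2) e[symmetric] using e0[of "\<T>\<^sub>m (\<alpha> i)"] i by simp
  qed (use h k rk x in simp_all)
qed (use h k eq0 in simp_all)

text \<open>If one chart contains \<open>x\<close> and \<open>b\<close>, the vector that moves \<open>x\<close> to \<open>b\<close> is the quotient of their
  fibre coordinates, computed by the inverse of the shear map.\<close>

lemma tangent_action_local:
  assumes x: "x \<in> Arr X" "Cod X x = \<T> P" and b: "b \<in> Arr X" "Cod X b = \<T> P" "Dom X b = Dom X x"
    and over: "x \<cdot> \<T>\<^sub>m q = b \<cdot> \<T>\<^sub>m q" and i: "i \<in> I"
    and rx: "\<rho> (x \<cdot> \<T>\<^sub>m (\<alpha> i)) = \<rho> x" and rb: "\<rho> (b \<cdot> \<T>\<^sub>m (\<alpha> i)) = \<rho> b"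
  obtains h where "h \<in> Arr X" "Dom X h = Dom X x" "Cod X h = \<T> (P \<otimes> G)" "\<rho> h = \<rho> x"
    "h \<cdot> \<T>\<^sub>m (\<pi>\<^sub>0 P G) = x" "h \<cdot> \<T>\<^sub>m \<a> = b"
proof -
  note \<gamma> = fibre_pair[OF i]
  have xb: "\<rho> b = \<rho> x"
    using rst_cmp_total[of "\<T>\<^sub>m q" x] rst_cmp_total[of "\<T>\<^sub>m q" b] x b over by simp
  let ?xi = "x \<cdot> (\<T>\<^sub>m (\<alpha> i) \<cdot> \<T>\<^sub>m (\<pi>\<^sub>1 M G))" and ?bi = "b \<cdot> (\<T>\<^sub>m (\<alpha> i) \<cdot> \<T>\<^sub>m (\<pi>\<^sub>1 M G))"
  have rxi: "\<rho> ?xi = \<rho> x" 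
    using rst_cmp_total[of "\<T>\<^sub>m (\<pi>\<^sub>1 M G)" "x \<cdot> \<T>\<^sub>m (\<alpha> i)"] x i rx by simp
  have rbi: "\<rho> ?bi = \<rho> x"
    using rst_cmp_total[of "\<T>\<^sub>m (\<pi>\<^sub>1 M G)" "b \<cdot> \<T>\<^sub>m (\<alpha> i)"] b i rb xb by simp
  obtain l where l: "l \<in> Arr X" "Dom X l = Dom X x" "Cod X l = \<T> (G \<otimes> G)"
    "l \<cdot> \<T>\<^sub>m (\<pi>\<^sub>0 G G) = ?xi" "l \<cdot> \<T>\<^sub>m (\<pi>\<^sub>1 G G) = ?bi" "\<rho> l = \<rho> x"
    by (rule tprd_pair[of ?xi ?bi G G]) (use x b i rxi rbi in simp_all)
  \<comment> \<open>In coordinates \<open>l = (g, g')\<close> and \<open>?k\<close> is the quotient of \<open>g'\<close> by \<open>g\<close>.\<close>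
  let ?k = "l \<cdot> (\<T>\<^sub>m unshear \<cdot> \<T>\<^sub>m (\<pi>\<^sub>1 G G))"
  obtain h where h: "h \<in> Arr X" "Dom X h = Dom X x" "Cod X h = \<T> (P \<otimes> G)"
    "h \<cdot> \<T>\<^sub>m (\<pi>\<^sub>0 P G) = x" "h \<cdot> \<T>\<^sub>m (\<pi>\<^sub>1 P G) = ?k" "\<rho> h = \<rho> x"
    by (rule tprd_pair[of x ?k P G]) (use x l in simp_all)
  note H = tangent_fibre_pair[OF h(1,3) i]
  have h0: "h \<cdot> (\<T>\<^sub>m (\<pi>\<^sub>0 P G) \<cdot> t) = x \<cdot> t" if "t \<in> Arr X" "Dom X t = \<T> P" for t
    using cmp_extend[OF h(4), of t] h that by simp
  have up: "\<T>\<^sub>m unshear \<cdot> \<T>\<^sub>m (\<pi>\<^sub>0 G G) = \<T>\<^sub>m (\<pi>\<^sub>0 G G)" "\<T>\<^sub>m unshear \<cdot> \<T>\<^sub>m m = \<T>\<^sub>m (\<pi>\<^sub>1 G G)"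
    using tmap_functor[of unshear "\<pi>\<^sub>0 G G"] tmap_functor[of unshear m]
    by (simp_all add: shear_prj unshear_mult)
  have rk: "\<rho> x \<cdot> ?k = ?k" using rst_self_extend[of l "\<T>\<^sub>m unshear \<cdot> \<T>\<^sub>m (\<pi>\<^sub>1 G G)"] l by simp
  have "h \<cdot> \<T>\<^sub>m (\<gamma> i) = l \<cdot> \<T>\<^sub>m unshear"
    by (rule tprd_ext[of G G]) (use h l x i \<gamma>(1-3) H(1,2) h0 rx rk up in simp_all)
  from cmp_extend[OF this, of "\<T>\<^sub>m m"]
  have "h \<cdot> (\<T>\<^sub>m (\<gamma> i) \<cdot> \<T>\<^sub>m m) = ?bi" using h l \<gamma>(1-3) up by simp
  then have "\<rho> x \<cdot> (h \<cdot> (\<T>\<^sub>m \<a> \<cdot> (\<T>\<^sub>m (\<alpha> i) \<cdot> \<T>\<^sub>m (\<pi>\<^sub>1 M G)))) = ?bi"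
    unfolding H(3) using h0 i rx by simp
  then have a1: "h \<cdot> (\<T>\<^sub>m \<a> \<cdot> (\<T>\<^sub>m (\<alpha> i) \<cdot> \<T>\<^sub>m (\<pi>\<^sub>1 M G))) = ?bi"
    using rst_self_extend[of h "\<T>\<^sub>m \<a> \<cdot> (\<T>\<^sub>m (\<alpha> i) \<cdot> \<T>\<^sub>m (\<pi>\<^sub>1 M G))"] h i by simp
  let ?y = "h \<cdot> \<T>\<^sub>m \<a>"
  have ry: "\<rho> (?y \<cdot> \<T>\<^sub>m (\<alpha> i)) = \<rho> x"
    using arg_cong[OF a1, of "\<lambda>t. \<rho> t"] rst_cmp_total[of "\<T>\<^sub>m (\<pi>\<^sub>1 M G)" "?y \<cdot> \<T>\<^sub>m (\<alpha> i)"] h i rbi by simp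
  have chart0: "z \<cdot> (\<T>\<^sub>m (\<alpha> i) \<cdot> \<T>\<^sub>m (\<pi>\<^sub>0 M G)) = z \<cdot> \<T>\<^sub>m q"
    if "z \<in> Arr X" "Cod X z = \<T> P" "\<rho> (z \<cdot> \<T>\<^sub>m (\<alpha> i)) = \<rho> z" for z
    using arg_cong[OF chart_prj0[OF i], of "\<T>\<^sub>m"] i that
      cmp_extend[OF restrict_to_domain[of z "\<T>\<^sub>m (\<alpha> i)"], of "\<T>\<^sub>m q"] by simp
  have aq: "\<T>\<^sub>m \<a> \<cdot> \<T>\<^sub>m q = \<T>\<^sub>m (\<pi>\<^sub>0 P G) \<cdot> \<T>\<^sub>m q"
    using arg_cong[OF action_base, of "\<T>\<^sub>m"] by simp
  have a0: "?y \<cdot> (\<T>\<^sub>m (\<alpha> i) \<cdot> \<T>\<^sub>m (\<pi>\<^sub>0 M G)) = b \<cdot> (\<T>\<^sub>m (\<alpha> i) \<cdot> \<T>\<^sub>m (\<pi>\<^sub>0 M G))"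
    using chart0[of ?y] chart0[of b] h b rb ry over h0[of "\<T>\<^sub>m q"] by (simp add: aq)
  have "?y \<cdot> \<T>\<^sub>m (\<alpha> i) = b \<cdot> \<T>\<^sub>m (\<alpha> i)"
    by (rule tprd_ext[of M G]) (use h b i a0 a1 in simp_all)
  moreover have "z = z \<cdot> \<T>\<^sub>m (\<alpha> i) \<cdot> \<T>\<^sub>m (\<beta> i)"
    if "z \<in> Arr X" "Cod X z = \<T> P" "\<rho> (z \<cdot> \<T>\<^sub>m (\<alpha> i)) = \<rho> z" for z
    using restrict_to_domain[of z "\<T>\<^sub>m (\<alpha> i)"] that i tmap_functor[of "\<alpha> i" "\<beta> i"] by simp
  ultimately have "?y = b" using h b ry rb by (metis action_typing cmp_typing rst_cmp_total tmap_total tmap_typing)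
  then show ?thesis using that[of h] h by blast
qed

text \<open>The local quotients are compatible by uniqueness (\<open>tangent_action_free\<close>), which takes
  the place of a differentiated cocycle condition.\<close>

lemma tangent_action_transitive:
  assumes x: "x \<in> Arr X" "Cod X x = \<T> P" and b: "b \<in> Arr X" "Cod X b = \<T> P" "Dom X b = Dom X x"
    and over: "x \<cdot> \<T>\<^sub>m q = b \<cdot> \<T>\<^sub>m q" and base: "x \<cdot> \<p> P = b \<cdot> \<p> P"
  obtains h where "h \<in> Arr X" "Dom X h = Dom X x" "Cod X h = \<T> (P \<otimes> G)" "\<rho> h = \<rho> x"
    "h \<cdot> \<T>\<^sub>m (\<pi>\<^sub>0 P G) = x" "h \<cdot> \<T>\<^sub>m \<a> = b"
proof -
  \<comment> \<open>The common base point; the cover along which the local solutions are glued comes from \<open>y\<close>.\<close>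
  define y where "y = b \<cdot> \<p> P"
  have y: "y \<in> Arr X" "Cod X y = P" "Dom X y = Dom X x" using b by (simp_all add: y_def)
  have rb: "\<rho> b = \<rho> y" using b by (simp add: y_def)
  have rx: "\<rho> x = \<rho> y" using rst_cmp_total[of "\<p> P" x] x base by (simp add: y_def)
  define e where "e i = \<rho> (y \<cdot> \<alpha> i)" for i
  have e: "e i \<in> Arr X" "Dom X (e i) = Dom X x" "Cod X (e i) = Dom X x" "\<rho> (e i) = e i"
    "e i \<cdot> e i = e i" "e i \<cdot> \<rho> y = e i" if "i \<in> I" for i
    using y that by (simp_all add: e_def)
  have re: "\<rho> (e i \<cdot> t) = e i \<cdot> \<rho> t" if "i \<in> I" "t \<in> Arr X" "Dom X t = Dom X x" for i t
    using rst_rst_left[of t "y \<cdot> \<alpha> i"] y that by (simp add: e_def)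
  have comm: "e i \<cdot> (e j \<cdot> t) = e j \<cdot> (e i \<cdot> t)" if "i \<in> I" "j \<in> I" "t \<in> Arr X" "Dom X t = Dom X x" for i j t
    using cmp_extend[OF rst_comm[of "y \<cdot> \<alpha> i" "y \<cdot> \<alpha> j"], of t] y that by (simp add: e_def)
  have ch: "\<rho> (x \<cdot> \<T>\<^sub>m (\<alpha> i)) = e i" "\<rho> (b \<cdot> \<T>\<^sub>m (\<alpha> i)) = e i" if "i \<in> I" for i
    using rst_cmp_tmap[of x "\<alpha> i"] rst_cmp_tmap[of b "\<alpha> i"] cmp_extend[OF base, of "\<alpha> i"] x b that
    by (simp_all add: e_def y_def)
  have "\<exists>h. h \<in> Arr X \<and> Dom X h = Dom X x \<and> Cod X h = \<T> (P \<otimes> G) \<and> \<rho> h = e i \<and>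
      h \<cdot> \<T>\<^sub>m (\<pi>\<^sub>0 P G) = e i \<cdot> x \<and> h \<cdot> \<T>\<^sub>m \<a> = e i \<cdot> b" if i: "i \<in> I" for i
  proof (rule tangent_action_local[of "e i \<cdot> x" "e i \<cdot> b" i])
    show "e i \<cdot> x \<cdot> \<T>\<^sub>m q = e i \<cdot> b \<cdot> \<T>\<^sub>m q" using over e[OF i] x b by simp
    show "\<rho> (e i \<cdot> x \<cdot> \<T>\<^sub>m (\<alpha> i)) = \<rho> (e i \<cdot> x)" "\<rho> (e i \<cdot> b \<cdot> \<T>\<^sub>m (\<alpha> i)) = \<rho> (e i \<cdot> b)"
      using e[OF i] x b i ch[OF i] rx rb by (simp_all add: re[OF i])
    fix h assume "h \<in> Arr X" "Dom X h = Dom X (e i \<cdot> x)" "Cod X h = \<T> (P \<otimes> G)"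
      "\<rho> h = \<rho> (e i \<cdot> x)" "h \<cdot> \<T>\<^sub>m (\<pi>\<^sub>0 P G) = e i \<cdot> x" "h \<cdot> \<T>\<^sub>m \<a> = e i \<cdot> b"
    then show ?thesis using e[OF i] x rx by (intro exI[of _ h]) (simp add: re[OF i])
  qed (use x b e[OF i] i in simp_all)
  then have "\<forall>i\<in>I. \<exists>h. h \<in> Arr X \<and> Dom X h = Dom X x \<and> Cod X h = \<T> (P \<otimes> G) \<and> \<rho> h = e i \<and>
      h \<cdot> \<T>\<^sub>m (\<pi>\<^sub>0 P G) = e i \<cdot> x \<and> h \<cdot> \<T>\<^sub>m \<a> = e i \<cdot> b" by blast
  from bchoice[OF this] obtain f where f: "f i \<in> Arr X" "Dom X (f i) = Dom X x" "Cod X (f i) = \<T> (P \<otimes> G)"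
    "\<rho> (f i) = e i" "f i \<cdot> \<T>\<^sub>m (\<pi>\<^sub>0 P G) = e i \<cdot> x" "f i \<cdot> \<T>\<^sub>m \<a> = e i \<cdot> b" if "i \<in> I" for i
    by blast
  have compat: "e i \<cdot> f j = e j \<cdot> f i" if ij: "i \<in> I" "j \<in> I" for i j
    by (rule tangent_action_free)
      (use f[OF ij(1)] f[OF ij(2)] e[OF ij(1)] e[OF ij(2)] x b comm[OF ij] in simp_all)
  obtain h where h: "h \<in> Arr X" "Dom X h = Dom X y" "Cod X h = \<T> (P \<otimes> G)" "\<rho> h = \<rho> y"
    and loc: "\<And>i. i \<in> I \<Longrightarrow> \<rho> (y \<cdot> \<alpha> i) \<cdot> h = f i"
  proof (rule chart_glue[OF y(1,2), of "\<T> (P \<otimes> G)" f])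
    show "\<rho> (y \<cdot> \<alpha> i) \<cdot> f j = \<rho> (y \<cdot> \<alpha> j) \<cdot> f i" if "i \<in> I" "j \<in> I" for i j
      using compat[OF that] by (simp add: e_def)
  qed (use f y in \<open>simp_all add: e_def\<close>)
  have "h \<cdot> \<T>\<^sub>m (\<pi>\<^sub>0 P G) = x"
  proof (rule chart_local_eq[OF y(1,2)])
    fix i assume i: "i \<in> I"
    show "\<rho> (y \<cdot> \<alpha> i) \<cdot> (h \<cdot> \<T>\<^sub>m (\<pi>\<^sub>0 P G)) = \<rho> (y \<cdot> \<alpha> i) \<cdot> x"
      using cmp_extend[OF loc[OF i], of "\<T>\<^sub>m (\<pi>\<^sub>0 P G)"] f(5)[OF i] h y i by (simp add: e_def)
  qed (use h x y rx in simp_all)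
  moreover have "h \<cdot> \<T>\<^sub>m \<a> = b"
  proof (rule chart_local_eq[OF y(1,2)])
    fix i assume i: "i \<in> I"
    show "\<rho> (y \<cdot> \<alpha> i) \<cdot> (h \<cdot> \<T>\<^sub>m \<a>) = \<rho> (y \<cdot> \<alpha> i) \<cdot> b"
      using cmp_extend[OF loc[OF i], of "\<T>\<^sub>m \<a>"] f(6)[OF i] h y i by (simp add: e_def)
  qed (use h b y rb in simp_all)
  ultimately show ?thesis using that[of h] h y rx by simp
qed

text \<open>The zero section embeds elements of \<open>P \<otimes> G\<close> into tangent vectors and is natural, so freeness
  of the action follows from freeness of its differential.\<close>

lemma action_free:
  assumes h: "h \<in> Arr X" "Cod X h = P \<otimes> G" and k: "k \<in> Arr X" "Cod X k = P \<otimes> G" "Dom X k = Dom X h"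
    and eq: "h \<cdot> \<pi>\<^sub>0 P G = k \<cdot> \<pi>\<^sub>0 P G" "h \<cdot> \<a> = k \<cdot> \<a>"
  shows "h = k"
proof -
  have "h \<cdot> \<zero> (P \<otimes> G) = k \<cdot> \<zero> (P \<otimes> G)"
    by (rule tangent_action_free)
      (use h k cmp_extend[OF eq(1), of "\<zero> P"] cmp_extend[OF eq(2), of "\<zero> P"] in
        \<open>simp_all add: zero_natural[of _ "P \<otimes> G" P]\<close>)
  from arg_cong[OF this, of "\<lambda>t. t \<cdot> \<p> (P \<otimes> G)"] show ?thesis using h k by simp
qed

text \<open>The map \<open>v\<close> sends \<open>(x, k)\<close> to \<open>\<T>\<^sub>m \<a> (0\<^sub>x, k)\<close>. Its inverse on a vertical vector \<open>b\<close> is the base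
  point of \<open>b\<close> together with the vector that moves the zero vector there to \<open>b\<close>.\<close>

lemma vertical_bundle_pullback:
  assumes K: "restriction_pullback X (\<p> G) u K r s"
  obtains v where "restriction_pullback X (\<T>\<^sub>m q) (\<zero> M) (P \<otimes> K) v (\<pi>\<^sub>0 P K \<cdot> q)"
proof -
  have rs: "r \<in> Arr X" "Dom X r = K" "Cod X r = \<T> G" "total X r"
    "s \<in> Arr X" "Dom X s = K" "Cod X s = term_obj X" "total X s" "r \<cdot> \<p> G = s \<cdot> u"
    using K by (auto simp: restriction_pullback_def total_hom_iff)
  have K_Obj [simp]: "K \<in> Obj X" using Dom_in_Obj[OF rs(1)] rs(2) by simp
  \<comment> \<open>The unit section \<open>x \<mapsto> (x, 1)\<close>.\<close>
  define \<eta> where "\<eta> = \<langle>\<one> P, bang X P \<cdot> u\<rangle>"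
  have \<eta>: "\<eta> \<in> Arr X" "Dom X \<eta> = P" "Cod X \<eta> = P \<otimes> G" "\<eta> \<cdot> \<pi>\<^sub>0 P G = \<one> P"
    "\<eta> \<cdot> \<pi>\<^sub>1 P G = bang X P \<cdot> u" "\<eta> \<cdot> \<a> = \<one> P"
    using action_unit by (simp_all add: \<eta>_def totalD)
  \<comment> \<open>\<open>j\<close> sends \<open>(x, k)\<close> to \<open>(0\<^sub>x, k)\<close>.\<close>
  obtain j where j: "j \<in> Arr X" "Dom X j = P \<otimes> K" "Cod X j = \<T> (P \<otimes> G)"
    "j \<cdot> \<T>\<^sub>m (\<pi>\<^sub>0 P G) = \<pi>\<^sub>0 P K \<cdot> \<zero> P" "j \<cdot> \<T>\<^sub>m (\<pi>\<^sub>1 P G) = \<pi>\<^sub>1 P K \<cdot> r" "\<rho> j = \<one> (P \<otimes> K)"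
    by (rule tprd_pair[of "\<pi>\<^sub>0 P K \<cdot> \<zero> P" "\<pi>\<^sub>1 P K \<cdot> r" P G]) (use rs in \<open>simp_all add: totalD\<close>)
  have j_total: "total X j" using j by (simp add: total_def)
  have sK: "\<pi>\<^sub>1 P K \<cdot> s = \<pi>\<^sub>0 P K \<cdot> bang X P"
    by (rule into_term_obj_eq) (use rs in \<open>simp_all add: totalD\<close>)
  have jp: "j \<cdot> \<p> (P \<otimes> G) = \<pi>\<^sub>0 P K \<cdot> \<eta>"
  proof (rule prd_ext[of P G])
    show "j \<cdot> \<p> (P \<otimes> G) \<cdot> \<pi>\<^sub>0 P G = \<pi>\<^sub>0 P K \<cdot> \<eta> \<cdot> \<pi>\<^sub>0 P G"
      using j \<eta> cmp_extend[OF j(4), of "\<p> P"] by (simp flip: proj_natural[of _ "P \<otimes> G" P])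
    show "j \<cdot> \<p> (P \<otimes> G) \<cdot> \<pi>\<^sub>1 P G = \<pi>\<^sub>0 P K \<cdot> \<eta> \<cdot> \<pi>\<^sub>1 P G"
      using j \<eta> cmp_extend[OF j(5), of "\<p> G"] rs cmp_extend[OF sK, of u]
      by (simp flip: proj_natural[of _ "P \<otimes> G" G])
  qed (use j \<eta> in simp_all)
  define v where "v = j \<cdot> \<T>\<^sub>m \<a>"
  have v: "v \<in> Arr X" "Dom X v = P \<otimes> K" "Cod X v = \<T> P" "total X v"
    using j j_total by (simp_all add: v_def)
  have vp: "v \<cdot> \<p> P = \<pi>\<^sub>0 P K"
    using j \<eta> cmp_extend[OF jp, of \<a>] by (simp add: v_def proj_natural[of \<a> "P \<otimes> G" P])
  have aq: "\<T>\<^sub>m \<a> \<cdot> \<T>\<^sub>m q = \<T>\<^sub>m (\<pi>\<^sub>0 P G) \<cdot> \<T>\<^sub>m q"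
    using arg_cong[OF action_base, of "\<T>\<^sub>m"] by simp
  have vq: "v \<cdot> \<T>\<^sub>m q = \<pi>\<^sub>0 P K \<cdot> q \<cdot> \<zero> M"
    using j aq cmp_extend[OF j(4), of "\<T>\<^sub>m q"] by (simp add: v_def zero_natural[of q P M])
  have univ: "\<exists>!h. h \<in> hom X Z (P \<otimes> K) \<and> h \<cdot> v = b \<and> h \<cdot> (\<pi>\<^sub>0 P K \<cdot> q) = c"
    if b: "b \<in> hom X Z (\<T> P)" and c: "c \<in> hom X Z M" and bc: "b \<cdot> \<T>\<^sub>m q = c \<cdot> \<zero> M" for Z b c
  proof -
    have b': "b \<in> Arr X" "Dom X b = Z" "Cod X b = \<T> P" and c': "c \<in> Arr X" "Dom X c = Z" "Cod X c = M"
      using b c by (auto simp: hom_iff)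
    have bq: "b \<cdot> (\<p> P \<cdot> q) = c"
      using cmp_extend[OF bc, of "\<p> M"] b' c' by (simp add: proj_natural[of q P M])
    \<comment> \<open>The zero vector at the base point of \<open>b\<close>.\<close>
    define x where "x = b \<cdot> (\<p> P \<cdot> \<zero> P)"
    have x: "x \<in> Arr X" "Dom X x = Z" "Cod X x = \<T> P" "\<rho> x = \<rho> b" using b' by (simp_all add: x_def)
    obtain t where t: "t \<in> Arr X" "Dom X t = Z" "Cod X t = \<T> (P \<otimes> G)" "\<rho> t = \<rho> b"
      "t \<cdot> \<T>\<^sub>m (\<pi>\<^sub>0 P G) = x" "t \<cdot> \<T>\<^sub>m \<a> = b"
    proof (rule tangent_action_transitive[of x b])
      show "x \<cdot> \<T>\<^sub>m q = b \<cdot> \<T>\<^sub>m q"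
        using b' c' bc cmp_extend[OF bq, of "\<zero> M"] by (simp add: x_def zero_natural[of q P M])
      show "x \<cdot> \<p> P = b \<cdot> \<p> P" using b' by (simp add: x_def)
    qed (use x b' in simp_all)
    \<comment> \<open>Both sides have the base point of \<open>b\<close> as first component and act trivially on it.\<close>
    have tp: "t \<cdot> \<p> (P \<otimes> G) = b \<cdot> (\<p> P \<cdot> \<eta>)"
    proof (rule action_free)
      show "t \<cdot> \<p> (P \<otimes> G) \<cdot> \<pi>\<^sub>0 P G = b \<cdot> (\<p> P \<cdot> \<eta>) \<cdot> \<pi>\<^sub>0 P G"
        using t \<eta> b' cmp_extend[OF t(5), of "\<p> P"]
        by (simp add: x_def flip: proj_natural[of _ "P \<otimes> G" P])
      show "t \<cdot> \<p> (P \<otimes> G) \<cdot> \<a> = b \<cdot> (\<p> P \<cdot> \<eta>) \<cdot> \<a>"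
        using t \<eta> b' cmp_extend[OF t(6), of "\<p> P"]
        by (simp flip: proj_natural[of _ "P \<otimes> G" P])
    qed (use t b' \<eta> in simp_all)
    have "t \<cdot> \<T>\<^sub>m (\<pi>\<^sub>1 P G) \<cdot> \<p> G = b \<cdot> (\<p> P \<cdot> bang X P) \<cdot> u"
      using t b' \<eta> cmp_extend[OF tp, of "\<pi>\<^sub>1 P G"] by (simp add: proj_natural[of _ "P \<otimes> G" G])
    moreover have "t \<cdot> \<T>\<^sub>m (\<pi>\<^sub>1 P G) \<in> hom X Z (\<T> G)" "b \<cdot> (\<p> P \<cdot> bang X P) \<in> hom X Z (term_obj X)"
      using t b' by (auto simp: hom_iff)
    ultimately have "\<exists>!k. k \<in> hom X Z K \<and> k \<cdot> r = t \<cdot> \<T>\<^sub>m (\<pi>\<^sub>1 P G) \<and> k \<cdot> s = b \<cdot> (\<p> P \<cdot> bang X P)"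
      using K unfolding restriction_pullback_def by simp
    then obtain k where k: "k \<in> hom X Z K" "k \<cdot> r = t \<cdot> \<T>\<^sub>m (\<pi>\<^sub>1 P G)" by blast
    have k': "k \<in> Arr X" "Dom X k = Z" "Cod X k = K" using k by (auto simp: hom_iff)
    have rk: "\<rho> k = \<rho> b"
      using rst_cmp_total[of r k] k k' rs t by simp
    have k0: "\<rho> b \<cdot> k = k" using rst_self[of k] k' rk by simp
    define h where "h = \<langle>b \<cdot> \<p> P, k\<rangle>"
    have h: "h \<in> Arr X" "Dom X h = Z" "Cod X h = P \<otimes> K" "h \<cdot> \<pi>\<^sub>0 P K = b \<cdot> \<p> P" "h \<cdot> \<pi>\<^sub>1 P K = k"
      using b' k' rk k0 by (simp_all add: h_def)
    have hj: "h \<cdot> j = t"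
    proof (rule tprd_ext[of P G])
      show "h \<cdot> j \<cdot> \<T>\<^sub>m (\<pi>\<^sub>0 P G) = t \<cdot> \<T>\<^sub>m (\<pi>\<^sub>0 P G)"
        using h j t cmp_extend[OF h(4), of "\<zero> P"] b' by (simp add: x_def)
      show "h \<cdot> j \<cdot> \<T>\<^sub>m (\<pi>\<^sub>1 P G) = t \<cdot> \<T>\<^sub>m (\<pi>\<^sub>1 P G)"
        using h j t cmp_extend[OF h(5), of r] k rs by simp
    qed (use h j t in simp_all)
    have hv: "h \<cdot> v = b" using cmp_extend[OF hj, of "\<T>\<^sub>m \<a>"] h j t by (simp add: v_def)
    have hq: "h \<cdot> (\<pi>\<^sub>0 P K \<cdot> q) = c" using cmp_extend[OF h(4), of q] h b' bq by simp
    show ?thesis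
    proof (rule ex1I[of _ h])
      show "h \<in> hom X Z (P \<otimes> K) \<and> h \<cdot> v = b \<and> h \<cdot> (\<pi>\<^sub>0 P K \<cdot> q) = c"
        using h hv hq by (simp add: hom_iff)
      fix h' assume "h' \<in> hom X Z (P \<otimes> K) \<and> h' \<cdot> v = b \<and> h' \<cdot> (\<pi>\<^sub>0 P K \<cdot> q) = c"
      then have h': "h' \<in> Arr X" "Dom X h' = Z" "Cod X h' = P \<otimes> K" "h' \<cdot> v = b"
        by (auto simp: hom_iff)
      have rh': "\<rho> h' = \<rho> b" using rst_cmp_total[of v h'] h' v by simp
      have h'0: "h' \<cdot> \<pi>\<^sub>0 P K = b \<cdot> \<p> P" using cmp_extend[OF h'(4), of "\<p> P"] h' v vp by simp
      have h'j: "h' \<cdot> j = t"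
      proof (rule tangent_action_free)
        show "h' \<cdot> j \<cdot> \<T>\<^sub>m (\<pi>\<^sub>0 P G) = t \<cdot> \<T>\<^sub>m (\<pi>\<^sub>0 P G)"
          using h' j t cmp_extend[OF h'0, of "\<zero> P"] b' by (simp add: x_def)
        show "h' \<cdot> j \<cdot> \<T>\<^sub>m \<a> = t \<cdot> \<T>\<^sub>m \<a>" using h' j t by (simp add: v_def)
      qed (use h' j t in simp_all)
      have "h' \<cdot> \<pi>\<^sub>1 P K = k"
      proof -
        let ?k = "h' \<cdot> \<pi>\<^sub>1 P K"
        have r: "?k \<cdot> r = k \<cdot> r"
          using cmp_extend[OF h'j, of "\<T>\<^sub>m (\<pi>\<^sub>1 P G)"] h' j k rs t by simp
        have s: "?k \<cdot> s = k \<cdot> s"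
          by (rule into_term_obj_eq) (use h' k' rs rk rh' in simp_all)
        have "k \<cdot> r \<cdot> \<p> G = k \<cdot> s \<cdot> u" using rs k' by simp
        moreover have "k \<cdot> r \<in> hom X Z (\<T> G)" "k \<cdot> s \<in> hom X Z (term_obj X)"
          using rs k' by (auto simp: hom_iff)
        ultimately have "\<exists>!l. l \<in> hom X Z K \<and> l \<cdot> r = k \<cdot> r \<and> l \<cdot> s = k \<cdot> s"
          using K unfolding restriction_pullback_def by simp
        moreover have "?k \<in> hom X Z K" using h' by (simp add: hom_iff)
        ultimately show ?thesis using r s k(1) by blast
      qed
      then have *: "h' \<cdot> \<pi>\<^sub>1 P K = h \<cdot> \<pi>\<^sub>1 P K" using h by simp
      show "h' = h"
        by (rule prd_ext[of P K]) (use * h h' h'0 in simp_all)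
    qed
  qed
  have "restriction_pullback X (\<T>\<^sub>m q) (\<zero> M) (P \<otimes> K) v (\<pi>\<^sub>0 P K \<cdot> q)"
    unfolding restriction_pullback_def using v vq univ by (auto simp: total_hom_iff)
  then show ?thesis using that by blast
qed

end

theorem theorem11:
  fixes X :: "('o, 'a, 'z) tangent_rcat_scheme"
    and I :: "'i set"
  assumes "cartesian_tangent_join_restriction_category X"
    and "group_object X G m u \<iota>"
    and "principal_bundle X G m u \<iota> M P q I \<alpha> \<tau>"
    and "restriction_pullback X (\<p>\<^bsub>X\<^esub> G) u TGu r s"
  shows "(\<exists>V v w. restriction_pullback X (\<T>\<^sub>m\<^bsub>X\<^esub> q) (\<zero>\<^bsub>X\<^esub> M) V v w) \<and>
         (\<forall>V v w. restriction_pullback X (\<T>\<^sub>m\<^bsub>X\<^esub> q) (\<zero>\<^bsub>X\<^esub> M) V v w \<longrightarrow>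
            isomorphic X V (P \<otimes>\<^bsub>X\<^esub> TGu))"
proof -
  interpret tangent_principal_bundle X G m u \<iota> M P q I \<alpha> \<tau>
    using assms(1,3) by (rule tangent_principal_bundle.intro)
  obtain v where "restriction_pullback X (\<T>\<^sub>m\<^bsub>X\<^esub> q) (\<zero>\<^bsub>X\<^esub> M) (P \<otimes>\<^bsub>X\<^esub> TGu) v (\<pi>\<^sub>0\<^bsub>X\<^esub> P TGu \<cdot>\<^bsub>X\<^esub> q)"
    using vertical_bundle_pullback[OF assms(4)] .
  then show ?thesis using restriction_pullback_unique by blast
qed

end
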